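(* Let $\Gamma$ be a finite simplicial graph whose edges are labeled by even integers $\geq 2$, and let $G = G_{\Gamma}$ be the associated (even) Artin group. Suppose that every closed reduced path in $\Gamma$ all of whose edges have labels bigger than $2$ has odd length. Then $$\Sigma^1(G)=\{[\chi]\in S(G) \mid \mathcal{L}(\chi) \text{ is a connected dominant subgraph of } \Gamma \}.$$
   Context: Artin groups. For a finite simplicial graph $\Gamma$ with vertex set $V(\Gamma)$, edge set $E(\Gamma)$ and edges labeled by integers $\geq 2$, the Artin group $G_\Gamma$ is generated by $V(\Gamma)$ with one relation $$\underbrace{uvu\cdots}_{n \text{ factors}}=\underbrace{vuv\cdots}_{n \text{ factors}}$$ for every edge of $\Gamma$ with vertices $u,v$ and label $n$. It is called even if all labels are even. Closed reduced paths. A closed reduced path in $\Gamma$ means a simple closed path (a cycle: at least three edges, with no vertex repeated except that the first and last vertices coincide); its length is its number of edges. Characters and $\Sigma^1$. For a finitely generated group $G$, $S(G)$ is the set of equivalence classes $[\chi]$ of non-zero homomorphisms $\chi: G\to\mathbb{R}$, where $\chi_1\sim\chi_2$ if and only if $\chi_1=r\chi_2$ for some real $r>0$. Put $G_\chi=\{g\in G\mid \chi(g)\ge 0\}$. Fix a finite generating set $Y$ of $G$ and the Cayley graph of $G$ with vertex set $G$ and edges joining $g$ to $gy$ ($g\in G$, $y\in Y$). Then $[\chi]\in\Sigma^1(G)$ if and only if the full subgraph of the Cayley graph spanned by the vertices in $G_\chi$ is connected (this does not depend on the choice of $Y$). Living subgraph. Let $\chi:G_\Gamma\to\mathbb{R}$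 be a non-zero character. An edge $e\in E(\Gamma)$ with vertices $u,v$ is dead if $\chi(u)=-\chi(v)$ and $e$ has an even label greater than $2$. Let $\mathcal{L}_{\mathcal{F}}(\chi)$ be the full (induced) subgraph of $\Gamma$ on the vertices $v\in V(\Gamma)$ with $\chi(v)\neq 0$. The living subgraph $\mathcal{L}(\chi)$ is obtained from $\mathcal{L}_{\mathcal{F}}(\chi)$ by removing all dead edges (keeping all vertices). Dominance. A subgraph $\Gamma_0$ of $\Gamma$ is dominant if for each $v\in V(\Gamma)\setminus V(\Gamma_0)$ there is an edge $e\in E(\Gamma)$ that links $v$ with a vertex of $V(\Gamma_0)$. *)

theory Defs
  imports Complex_Main "HOL-Algebra.Generated_Groups"
begin

section \<open>Groups given by a presentation\<close>

text \<open>The letter \<open>(s, True)\<close> stands for the generator \<open>s\<close>, and \<open>(s, False)\<close> for its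
  formal inverse.\<close>

type_synonym 'a word = "('a \<times> bool) list"

definition words :: "'a set \<Rightarrow> 'a word set" where
  "words S = lists (S \<times> UNIV)"

inductive word_eq :: "'a set \<Rightarrow> ('a word \<times> 'a word) set \<Rightarrow> 'a word \<Rightarrow> 'a word \<Rightarrow> bool"
  for S R where
  weq_refl: "w \<in> words S \<Longrightarrow> word_eq S R w w"
| weq_sym: "word_eq S R u v \<Longrightarrow> word_eq S R v u"
| weq_trans: "word_eq S R u v \<Longrightarrow> word_eq S R v w \<Longrightarrow> word_eq S R u w"
| weq_append: "word_eq S R u u' \<Longrightarrow> word_eq S R v v' \<Longrightarrow> word_eq S R (u @ v) (u' @ v')"
| weq_cancel: "s \<in> S \<Longrightarrow> word_eq S R [(s, b), (s, \<not> b)] []"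
| weq_relator: "(u, v) \<in> R \<Longrightarrow> u \<in> words S \<Longrightarrow> v \<in> words S \<Longrightarrow> word_eq S R u v"

definition word_rel :: "'a set \<Rightarrow> ('a word \<times> 'a word) set \<Rightarrow> ('a word \<times> 'a word) set" where
  "word_rel S R = {(u, v). word_eq S R u v}"

definition presented_group :: "'a set \<Rightarrow> ('a word \<times> 'a word) set \<Rightarrow> 'a word set monoid" where
  "presented_group S R =
     \<lparr>carrier = words S // word_rel S R,
      mult = (\<lambda>A B. \<Union>a\<in>A. \<Union>b\<in>B. word_rel S R `` {a @ b}),
      one = word_rel S R `` {[]}\<rparr>"

definition presented_gen :: "'a set \<Rightarrow> ('a word \<times> 'a word) set \<Rightarrow> 'a \<Rightarrow> 'a word set" where
  "presented_gen S R s = word_rel S R `` {[(s, True)]}"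

lemma word_eq_words: "word_eq S R u v \<Longrightarrow> u \<in> words S \<and> v \<in> words S"
  by (induction rule: word_eq.induct) (auto simp: words_def)

lemma equiv_word_rel: "equiv (words S) (word_rel S R)"
proof (rule equivI)
  show "word_rel S R \<subseteq> words S \<times> words S"
    using word_eq_words by (fastforce simp: word_rel_def)
  show "refl_on (words S) (word_rel S R)"
    by (auto simp: refl_on_def word_rel_def intro: word_eq.weq_refl)
  show "sym (word_rel S R)"
    by (auto simp: sym_def word_rel_def intro: word_eq.weq_sym)
  show "trans (word_rel S R)"
    unfolding trans_def word_rel_def by (blast intro: word_eq.weq_trans)
qed

lemma presented_mult:
  assumes "u \<in> words S" "v \<in> words S"
  shows "(word_rel S R `` {u}) \<otimes>\<^bsub>presented_group S R\<^esub> (word_rel S R `` {v}) = word_rel S R `` {u @ v}"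
proof -
  have eq: "word_rel S R `` {a @ b} = word_rel S R `` {u @ v}"
    if "a \<in> word_rel S R `` {u}" "b \<in> word_rel S R `` {v}" for a b
    using that equiv_class_eq[OF equiv_word_rel, of "u @ v" "a @ b" S R]
    by (auto simp: word_rel_def intro: word_eq.weq_append)
  have mem: "u \<in> word_rel S R `` {u}" "v \<in> word_rel S R `` {v}"
    using assms by (auto simp: word_rel_def intro: word_eq.weq_refl)
  have "(\<Union>a\<in>word_rel S R `` {u}. \<Union>b\<in>word_rel S R `` {v}. word_rel S R `` {a @ b}) =
      (\<Union>a\<in>word_rel S R `` {u}. \<Union>b\<in>word_rel S R `` {v}. word_rel S R `` {u @ v})"
    by (rule SUP_cong[OF refl], rule SUP_cong[OF refl], rule eq)
  also have "\<dots> = word_rel S R `` {u @ v}"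
    using mem by (metis UN_constant empty_iff)
  finally show ?thesis by (simp add: presented_group_def)
qed

definition inv_word :: "'a word \<Rightarrow> 'a word" where
  "inv_word w = rev (map (\<lambda>(s, b). (s, \<not> b)) w)"

lemma inv_word_words: "w \<in> words S \<Longrightarrow> inv_word w \<in> words S"
  by (auto simp: words_def inv_word_def)

lemma inv_word_left: "w \<in> words S \<Longrightarrow> word_eq S R (inv_word w @ w) []"
proof (induction w)
  case Nil
  then show ?case by (auto simp: inv_word_def intro: word_eq.weq_refl)
next
  case (Cons x w)
  obtain s b where x: "x = (s, b)" by force
  have s: "s \<in> S" and w: "w \<in> words S"
    using Cons.prems x by (auto simp: words_def)
  have "word_eq S R ([(s, \<not> b), (s, b)] @ w) ([] @ w)"
    using word_eq.weq_append[OF word_eq.weq_cancel[OF s, of R "\<not> b"] word_eq.weq_refl[OF w]] by simp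
  then have "word_eq S R (inv_word w @ ([(s, \<not> b), (s, b)] @ w)) (inv_word w @ w)"
    using word_eq.weq_append[OF word_eq.weq_refl[OF inv_word_words[OF w]]] by fastforce
  then show ?case
    using word_eq.weq_trans[OF _ Cons.IH[OF w]] by (simp add: x inv_word_def)
qed

lemma group_presented_group: "group (presented_group S R)"
proof (rule groupI)
  let ?G = "presented_group S R" and ?c = "\<lambda>w. word_rel S R `` {w}"
  have carr: "x \<in> carrier ?G \<longleftrightarrow> (\<exists>w\<in>words S. x = ?c w)" for x
    by (auto simp: presented_group_def quotient_def)
  have one: "\<one>\<^bsub>?G\<^esub> = ?c []" by (simp add: presented_group_def)
  have nil: "[] \<in> words S" by (simp add: words_def)
  have app: "u @ v \<in> words S" if "u \<in> words S" "v \<in> words S" for u v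
    using that by (auto simp: words_def)
  note mult = presented_mult[where S = S and R = R]
  show "x \<otimes>\<^bsub>?G\<^esub> y \<in> carrier ?G" if xy: "x \<in> carrier ?G" "y \<in> carrier ?G" for x y
  proof -
    obtain u v where "u \<in> words S" "x = ?c u" "v \<in> words S" "y = ?c v"
      using xy unfolding carr by blast
    then have "x \<otimes>\<^bsub>?G\<^esub> y = ?c (u @ v)" "u @ v \<in> words S"
      by (simp_all only: mult app)
    then show ?thesis unfolding carr by blast
  qed
  show "\<one>\<^bsub>?G\<^esub> \<in> carrier ?G" unfolding one carr using nil by blast
  show "x \<otimes>\<^bsub>?G\<^esub> y \<otimes>\<^bsub>?G\<^esub> z = x \<otimes>\<^bsub>?G\<^esub> (y \<otimes>\<^bsub>?G\<^esub> z)"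
    if xyz: "x \<in> carrier ?G" "y \<in> carrier ?G" "z \<in> carrier ?G" for x y z
  proof -
    obtain u v w where "u \<in> words S" "x = ?c u" "v \<in> words S" "y = ?c v"
      "w \<in> words S" "z = ?c w"
      using xyz unfolding carr by blast
    then show ?thesis by (simp only: mult app append_assoc)
  qed
  show "\<one>\<^bsub>?G\<^esub> \<otimes>\<^bsub>?G\<^esub> x = x" if x: "x \<in> carrier ?G" for x
  proof -
    obtain w where "w \<in> words S" "x = ?c w" using x unfolding carr by blast
    then show ?thesis by (simp only: one mult nil append_Nil)
  qed
  show "\<exists>y\<in>carrier ?G. y \<otimes>\<^bsub>?G\<^esub> x = \<one>\<^bsub>?G\<^esub>" if x: "x \<in> carrier ?G" for x
  proof -
    obtain w where w: "w \<in> words S" "x = ?c w" using x unfolding carr by blast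
    have "?c (inv_word w) \<otimes>\<^bsub>?G\<^esub> x = ?c (inv_word w @ w)"
      by (simp only: w mult inv_word_words)
    also have "\<dots> = ?c []"
      by (rule equiv_class_eq[OF equiv_word_rel])
        (simp add: word_rel_def inv_word_left[OF w(1)])
    finally have "?c (inv_word w) \<otimes>\<^bsub>?G\<^esub> x = \<one>\<^bsub>?G\<^esub>" by (simp only: one)
    moreover have "?c (inv_word w) \<in> carrier ?G"
      unfolding carr using inv_word_words[OF w(1)] by blast
    ultimately show ?thesis by blast
  qed
qed

lemma presented_gen_carrier: "s \<in> S \<Longrightarrow> presented_gen S R s \<in> carrier (presented_group S R)"
  by (auto simp: presented_group_def presented_gen_def quotient_def words_def)

lemma generate_presented_gen:
  "generate (presented_group S R) (presented_gen S R ` S) = carrier (presented_group S R)"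
proof
  let ?G = "presented_group S R" and ?c = "\<lambda>w. word_rel S R `` {w}"
  interpret group ?G by (rule group_presented_group)
  show "generate ?G (presented_gen S R ` S) \<subseteq> carrier ?G"
    by (rule generate_incl) (auto intro: presented_gen_carrier)
  have letter: "?c [(s, b)] \<in> generate ?G (presented_gen S R ` S)" if s: "s \<in> S" for s b
  proof (cases b)
    case True
    then show ?thesis
      using generate.incl[OF imageI[OF s], of "presented_gen S R" ?G]
      by (simp add: presented_gen_def)
  next
    case False
    have w: "[(s, b)] \<in> words S" for b using s by (simp add: words_def)
    then have c: "?c [(s, b)] \<in> carrier ?G" for b
      by (auto simp: presented_group_def quotient_def)
    have "?c [(s, False)] \<otimes>\<^bsub>?G\<^esub> ?c [(s, True)] = ?c [(s, False), (s, True)]"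
      by (simp only: presented_mult[OF w w] append_Cons append_Nil)
    also have "\<dots> = ?c []"
      using word_eq.weq_cancel[OF s, of R False]
      by (intro equiv_class_eq[OF equiv_word_rel]) (simp add: word_rel_def)
    also have "\<dots> = \<one>\<^bsub>?G\<^esub>" by (simp add: presented_group_def)
    finally have "inv\<^bsub>?G\<^esub> (presented_gen S R s) = ?c [(s, False)]"
      unfolding presented_gen_def by (rule inv_equality) (rule c)+
    moreover have "inv\<^bsub>?G\<^esub> (presented_gen S R s) \<in> generate ?G (presented_gen S R ` S)"
      using s by (intro generate.inv imageI)
    ultimately show ?thesis using False by simp
  qed
  have "?c w \<in> generate ?G (presented_gen S R ` S)" if "w \<in> words S" for w
    using that
  proof (induction w)
    case Nil
    then show ?case using generate.one[of ?G] by (simp add: presented_group_def)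
  next
    case (Cons x w)
    obtain s b where x: "x = (s, b)" by force
    have s: "s \<in> S" and w: "w \<in> words S" "[(s, b)] \<in> words S"
      using Cons.prems x by (auto simp: words_def)
    show ?case
      using generate.eng[OF letter[OF s, of b] Cons.IH[OF w(1)]]
      by (simp only: presented_mult[OF w(2,1)] x append_Cons append_Nil)
  qed
  then show "carrier ?G \<subseteq> generate ?G (presented_gen S R ` S)"
    by (auto simp: presented_group_def quotient_def)
qed


section \<open>Graphs\<close>

text \<open>Edges are the sets of their end points. Simpliciality is imposed separately: the Cayley
  graph below may have a loop \<open>{g}\<close>, which does not affect connectedness.\<close>

record 'a ugraph =
  verts :: "'a set"
  edges :: "'a set set"

record 'a labeled_graph = "'a ugraph" +
  label :: "'a set \<Rightarrow> nat"

definition finite_simplicial :: "('a, 'm) ugraph_scheme \<Rightarrow> bool" where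
  "finite_simplicial \<Gamma> \<longleftrightarrow>
     finite (verts \<Gamma>) \<and> (\<forall>e\<in>edges \<Gamma>. \<exists>u\<in>verts \<Gamma>. \<exists>v\<in>verts \<Gamma>. u \<noteq> v \<and> e = {u, v})"

definition connected_graph :: "('a, 'm) ugraph_scheme \<Rightarrow> bool" where
  "connected_graph \<Gamma> \<longleftrightarrow>
     (\<forall>u\<in>verts \<Gamma>. \<forall>v\<in>verts \<Gamma>.
        (u, v) \<in> {(x, y). x \<in> verts \<Gamma> \<and> y \<in> verts \<Gamma> \<and> {x, y} \<in> edges \<Gamma>}\<^sup>*)"

definition full_subgraph :: "('a, 'm) ugraph_scheme \<Rightarrow> 'a set \<Rightarrow> 'a ugraph" where
  "full_subgraph \<Gamma> W = \<lparr>verts = verts \<Gamma> \<inter> W, edges = {e \<in> edges \<Gamma>. e \<subseteq> W}\<rparr>"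

definition dominant :: "('a, 'm) ugraph_scheme \<Rightarrow> 'a ugraph \<Rightarrow> bool" where
  "dominant \<Gamma> \<Delta> \<longleftrightarrow> (\<forall>v \<in> verts \<Gamma> - verts \<Delta>. \<exists>u\<in>verts \<Delta>. {v, u} \<in> edges \<Gamma>)"

text \<open>A closed reduced path is given by the list of its distinct vertices, the initial vertex not
  being repeated at the end; hence the length of the list is the number of edges.\<close>

definition cycle_edges :: "'a list \<Rightarrow> 'a set set" where
  "cycle_edges vs = {{vs ! i, vs ! (Suc i mod length vs)} | i. i < length vs}"

definition closed_reduced_path :: "('a, 'm) ugraph_scheme \<Rightarrow> 'a list \<Rightarrow> bool" where
  "closed_reduced_path \<Gamma> vs \<longleftrightarrow>
     length vs \<ge> 3 \<and> distinct vs \<and> set vs \<subseteq> verts \<Gamma> \<and> cycle_edges vs \<subseteq> edges \<Gamma>"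


section \<open>Artin groups\<close>

fun alternating :: "'a \<Rightarrow> 'a \<Rightarrow> nat \<Rightarrow> 'a word" where
  "alternating u v 0 = []"
| "alternating u v (Suc n) = (u, True) # alternating v u n"

definition artin_relators :: "'a labeled_graph \<Rightarrow> ('a word \<times> 'a word) set" where
  "artin_relators \<Gamma> =
     {(alternating u v (label \<Gamma> {u, v}), alternating v u (label \<Gamma> {u, v})) | u v. {u, v} \<in> edges \<Gamma>}"

definition artin_group :: "'a labeled_graph \<Rightarrow> 'a word set monoid" where
  "artin_group \<Gamma> = presented_group (verts \<Gamma>) (artin_relators \<Gamma>)"

definition artin_gen :: "'a labeled_graph \<Rightarrow> 'a \<Rightarrow> 'a word set" where
  "artin_gen \<Gamma> v = presented_gen (verts \<Gamma>) (artin_relators \<Gamma>) v"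

lemma group_artin_group: "group (artin_group \<Gamma>)"
  by (simp add: artin_group_def group_presented_group)

lemma generate_artin_gen:
  "generate (artin_group \<Gamma>) (artin_gen \<Gamma> ` verts \<Gamma>) = carrier (artin_group \<Gamma>)"
  using generate_presented_gen[of "verts \<Gamma>" "artin_relators \<Gamma>"]
  by (simp add: artin_group_def artin_gen_def[abs_def])


section \<open>Characters and the first Sigma invariant\<close>

definition real_add_group :: "real monoid" where
  "real_add_group = \<lparr>carrier = UNIV, mult = (+), one = 0\<rparr>"

definition nonzero_characters :: "('g, 'm) monoid_scheme \<Rightarrow> ('g \<Rightarrow> real) set" where
  "nonzero_characters G = {\<chi> \<in> hom G real_add_group. \<exists>g\<in>carrier G. \<chi> g \<noteq> 0}"

text \<open>Functions are compared on the carrier only, so a class does not depend on the irrelevant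
  values of its members outside of it.\<close>

definition character_rel :: "('g, 'm) monoid_scheme \<Rightarrow> (('g \<Rightarrow> real) \<times> ('g \<Rightarrow> real)) set" where
  "character_rel G =
     {(\<chi>\<^sub>1, \<chi>\<^sub>2). \<chi>\<^sub>1 \<in> nonzero_characters G \<and> \<chi>\<^sub>2 \<in> nonzero_characters G \<and>
        (\<exists>r>0. \<forall>g\<in>carrier G. \<chi>\<^sub>1 g = r * \<chi>\<^sub>2 g)}"

definition character_class :: "('g, 'm) monoid_scheme \<Rightarrow> ('g \<Rightarrow> real) \<Rightarrow> ('g \<Rightarrow> real) set" where
  "character_class G \<chi> = character_rel G `` {\<chi>}"

definition cayley_graph :: "('g, 'm) monoid_scheme \<Rightarrow> 'g set \<Rightarrow> 'g ugraph" where
  "cayley_graph G Y =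
     \<lparr>verts = carrier G, edges = {{g, g \<otimes>\<^bsub>G\<^esub> y} | g y. g \<in> carrier G \<and> y \<in> Y}\<rparr>"

definition nonneg_part :: "('g, 'm) monoid_scheme \<Rightarrow> ('g \<Rightarrow> real) \<Rightarrow> 'g set" where
  "nonneg_part G \<chi> = {g \<in> carrier G. \<chi> g \<ge> 0}"

definition finite_generating_set :: "('g, 'm) monoid_scheme \<Rightarrow> 'g set \<Rightarrow> bool" where
  "finite_generating_set G Y \<longleftrightarrow> finite Y \<and> Y \<subseteq> carrier G \<and> generate G Y = carrier G"

definition Sigma1 :: "('g, 'm) monoid_scheme \<Rightarrow> 'g set \<Rightarrow> ('g \<Rightarrow> real) set set" where
  "Sigma1 G Y =
     {character_class G \<chi> | \<chi>. \<chi> \<in> nonzero_characters G \<and>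
        connected_graph (full_subgraph (cayley_graph G Y) (nonneg_part G \<chi>))}"


section \<open>The living subgraph\<close>

definition dead_edges :: "'a labeled_graph \<Rightarrow> ('a word set \<Rightarrow> real) \<Rightarrow> 'a set set" where
  "dead_edges \<Gamma> \<chi> =
     {{u, v} | u v. {u, v} \<in> edges \<Gamma> \<and> \<chi> (artin_gen \<Gamma> u) = - \<chi> (artin_gen \<Gamma> v) \<and>
        even (label \<Gamma> {u, v}) \<and> label \<Gamma> {u, v} > 2}"

definition living_full_subgraph :: "'a labeled_graph \<Rightarrow> ('a word set \<Rightarrow> real) \<Rightarrow> 'a ugraph" where
  "living_full_subgraph \<Gamma> \<chi> = full_subgraph \<Gamma> {v. \<chi> (artin_gen \<Gamma> v) \<noteq> 0}"

definition living_subgraph :: "'a labeled_graph \<Rightarrow> ('a word set \<Rightarrow> real) \<Rightarrow> 'a ugraph" where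
  "living_subgraph \<Gamma> \<chi> =
     \<lparr>verts = verts (living_full_subgraph \<Gamma> \<chi>),
      edges = edges (living_full_subgraph \<Gamma> \<chi>) - dead_edges \<Gamma> \<chi>\<rparr>"

end

theory Submission
  imports Defs
begin

text \<open>
  Sufficiency. In a positive direction \<open>x\<close>, each group element \<open>g\<close> spans a ray \<open>g x^k\<close>. Rays of
  commuting positive directions reach the same end, and for an edge of label \<open>2n\<close> the element
  \<open>(uv)^n\<close> commutes with \<open>u\<close> and \<open>v\<close>; it has nonzero character value unless the edge is dead or
  \<open>u\<close> and \<open>v\<close> commute. So along a connected living subgraph all generators define one and the
  same end; by dominance every generator fixes it. Hence any two elements of nonnegative character
  are joined by climbing to this end.

  Necessity. If two subsets generate parts of the group which fix different points of an affine
  action with linear part \<open>g \<mapsto> c(g) s^(\<chi> g)\<close> over a Novikov ring, then \<open>[\<chi>]\<close> is not in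
  \<open>\<Sigma>\<^sup>1\<close>. If a vertex violates dominance, let it act as a translation by 1 and all others
  linearly. If the living subgraph splits into \<open>A\<close> and \<open>B\<close>, let \<open>A\<close> fix 0 and \<open>B\<close> fix 1; all edges
  between them are dead, and they form a forest because a cycle of such edges has even length. So \<open>c\<close>
  can be chosen with \<open>c(a) c(b)\<close> a nontrivial root of unity of order dividing \<open>n\<close> for each of
  these edges, which makes \<open>(ab)^n\<close> act trivially.
\<close>

section \<open>Characters on a generated group\<close>

lemma ex_nat_above:
  assumes "0 < (a::real)"
  shows "\<exists>K::nat. \<forall>k\<ge>K. r \<le> real k * a"
proof -
  obtain K :: nat where "r / a \<le> real K" using real_arch_simple by blast
  then have "r \<le> real K * a" using assms by (simp add: field_simps)
  moreover have "real K * a \<le> real k * a" if "k \<ge> K" for k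
    using that assms by (simp add: mult_right_mono)
  ultimately show ?thesis by (meson order_trans)
qed

locale group_character = group G for G (structure) +
  fixes \<chi> :: "'a \<Rightarrow> real"
  assumes char_mult: "\<lbrakk>g \<in> carrier G; h \<in> carrier G\<rbrakk> \<Longrightarrow> \<chi> (g \<otimes> h) = \<chi> g + \<chi> h"
begin

lemma char_one [simp]: "\<chi> \<one> = 0"
  using char_mult[of \<one> \<one>] by simp

lemma char_inv [simp]: "g \<in> carrier G \<Longrightarrow> \<chi> (inv g) = - \<chi> g"
  using char_mult[of g "inv g"] by simp

lemma char_pow [simp]: "g \<in> carrier G \<Longrightarrow> \<chi> (g [^] (n::nat)) = real n * \<chi> g"
  by (induction n) (auto simp: char_mult algebra_simps)

text \<open>Rays must climb, but a generator may have negative character. It and its inverse have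
  the same centralizer, so the climbing one of the two may stand in for it.\<close>

definition pos :: "'a \<Rightarrow> 'a" where
  "pos x = (if \<chi> x > 0 then x else inv x)"

lemma pos_closed: "x \<in> carrier G \<Longrightarrow> pos x \<in> carrier G"
  by (simp add: pos_def)

lemma char_pos: "x \<in> carrier G \<Longrightarrow> \<chi> (pos x) = \<bar>\<chi> x\<bar>"
  by (simp add: pos_def)

lemma pos_commute:
  assumes "x \<in> carrier G" "z \<in> carrier G" and "x \<otimes> z = z \<otimes> x"
  shows "x \<otimes> pos z = pos z \<otimes> x"
proof -
  have "x \<otimes> inv z = inv z \<otimes> (z \<otimes> x) \<otimes> inv z"
    using assms(1,2) by (simp add: m_assoc[symmetric])
  also have "\<dots> = inv z \<otimes> x"
    using assms by (simp add: m_assoc flip: assms(3))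
  finally show ?thesis using assms(3) by (simp add: pos_def)
qed

end

section \<open>Paths above a given height in the Cayley graph\<close>

locale generated_character = group_character +
  fixes Y
  assumes gens_closed: "Y \<subseteq> carrier G" and generate_gens: "generate G Y = carrier G"
begin

text \<open>Arbitrary heights \<open>r\<close> are allowed: translation by \<open>f\<close> moves
  heights by \<open>\<chi> f\<close>, and ends look at all heights at once.\<close>

definition step_above :: "real \<Rightarrow> ('a \<times> 'a) set" where
  "step_above r = {(g, h). g \<in> carrier G \<and> h \<in> carrier G \<and> r \<le> \<chi> g \<and> r \<le> \<chi> h \<and>
     {g, h} \<in> edges (cayley_graph G Y)}"

definition conn_above :: "real \<Rightarrow> 'a \<Rightarrow> 'a \<Rightarrow> bool" where
  "conn_above r g h \<longleftrightarrow> (g, h) \<in> (step_above r)\<^sup>*"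

lemma connected_nonneg_part_iff:
  "connected_graph (full_subgraph (cayley_graph G Y) (nonneg_part G \<chi>)) \<longleftrightarrow>
    (\<forall>g\<in>nonneg_part G \<chi>. \<forall>h\<in>nonneg_part G \<chi>. conn_above 0 g h)"
proof -
  let ?\<Delta> = "full_subgraph (cayley_graph G Y) (nonneg_part G \<chi>)"
  have v: "verts ?\<Delta> = nonneg_part G \<chi>"
    by (auto simp: full_subgraph_def cayley_graph_def nonneg_part_def)
  have "{(x, y). x \<in> verts ?\<Delta> \<and> y \<in> verts ?\<Delta> \<and> {x, y} \<in> edges ?\<Delta>} = step_above 0"
    by (auto simp: full_subgraph_def cayley_graph_def nonneg_part_def step_above_def)
  then show ?thesis
    unfolding connected_graph_def conn_above_def v by simp
qed

lemma conn_above_refl [simp]: "conn_above r g g"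
  by (simp add: conn_above_def)

lemma conn_above_sym: "conn_above r g h \<Longrightarrow> conn_above r h g"
proof -
  have "sym (step_above r)"
    by (auto simp: sym_def step_above_def insert_commute)
  then show "conn_above r g h \<Longrightarrow> conn_above r h g"
    unfolding conn_above_def by (meson sym_rtrancl symD)
qed

lemma conn_above_trans [trans]:
  "\<lbrakk>conn_above r g h; conn_above r h k\<rbrakk> \<Longrightarrow> conn_above r g k"
  unfolding conn_above_def by (rule rtrancl_trans)

lemma conn_above_mono:
  assumes "conn_above r g h" "s \<le> r"
  shows "conn_above s g h"
proof -
  have "step_above r \<subseteq> step_above s"
    using assms(2) by (auto simp: step_above_def)
  then show ?thesis
    using assms(1) rtrancl_mono unfolding conn_above_def by blast
qed

text \<open>Edges come from multiplication on the right, so left multiplication is a graph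
  automorphism, and it shifts all heights by the same amount.\<close>

lemma conn_above_translate:
  assumes "conn_above r g h" "f \<in> carrier G"
  shows "conn_above (r + \<chi> f) (f \<otimes> g) (f \<otimes> h)"
  using assms(1) unfolding conn_above_def
proof (induction rule: rtrancl_induct)
  case (step h k)
  then obtain p y where py: "{h, k} = {p, p \<otimes> y}" "p \<in> carrier G" "y \<in> Y"
    by (auto simp: step_above_def cayley_graph_def)
  then have "{f \<otimes> h, f \<otimes> k} = {f \<otimes> p, (f \<otimes> p) \<otimes> y}"
    using assms(2) gens_closed by (auto simp: doubleton_eq_iff m_assoc subset_iff)
  moreover have "f \<otimes> p \<in> carrier G"
    using py assms(2) by simp
  ultimately have "{f \<otimes> h, f \<otimes> k} \<in> edges (cayley_graph G Y)"
    using py(3) unfolding cayley_graph_def by auto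
  then have "(f \<otimes> h, f \<otimes> k) \<in> step_above (r + \<chi> f)"
    using step.hyps(2) assms(2) by (auto simp: step_above_def char_mult)
  with step.IH show ?case by (rule rtrancl_into_rtrancl)
qed simp

lemma conn_above_generator:
  assumes "y \<in> Y" "h \<in> carrier G" "r \<le> \<chi> h" "r \<le> \<chi> h + \<chi> y"
  shows "conn_above r h (h \<otimes> y)"
proof -
  have "{h, h \<otimes> y} \<in> edges (cayley_graph G Y)"
    using assms by (auto simp: cayley_graph_def)
  then have "(h, h \<otimes> y) \<in> step_above r"
    using assms gens_closed by (auto simp: step_above_def char_mult subset_iff)
  then show ?thesis unfolding conn_above_def by (rule r_into_rtrancl)
qed

lemma conn_above_generator_inv:
  assumes "y \<in> Y" "h \<in> carrier G" "r \<le> \<chi> h" "r \<le> \<chi> h - \<chi> y"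
  shows "conn_above r h (h \<otimes> inv y)"
proof -
  have y: "y \<in> carrier G" using assms gens_closed by auto
  have "conn_above r (h \<otimes> inv y) (h \<otimes> inv y \<otimes> y)"
    using assms y by (intro conn_above_generator) (auto simp: char_mult)
  then show ?thesis
    using assms y by (simp add: m_assoc conn_above_sym)
qed

text \<open>A word for \<open>g\<close> in the generators traces a path from \<open>h\<close> to
  \<open>h \<otimes> g\<close>. How far it dips below \<open>h\<close> depends on the word and not
  on \<open>h\<close>; \<open>D\<close> bounds this dip.\<close>

lemma conn_above_mult:
  assumes "g \<in> carrier G"
  obtains D where "\<And>h r. h \<in> carrier G \<Longrightarrow> r \<le> \<chi> h - D \<Longrightarrow> conn_above r h (h \<otimes> g)"
proof -
  have "\<exists>D\<ge>0. \<forall>h\<in>carrier G. \<forall>r\<le>\<chi> h - D. conn_above r h (h \<otimes> g)"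
    if "g \<in> generate G Y" for g
    using that
  proof (induction rule: generate.induct)
    case one
    then show ?case by (auto intro!: exI[of _ 0])
  next
    case (incl y)
    then show ?case
      by (intro exI[of _ "\<bar>\<chi> y\<bar>"]) (auto intro!: conn_above_generator)
  next
    case (inv y)
    then show ?case
      by (intro exI[of _ "\<bar>\<chi> y\<bar>"]) (auto intro!: conn_above_generator_inv)
  next
    case (eng a b)
    have ab: "a \<in> carrier G" "b \<in> carrier G"
      using eng.hyps generate_gens by auto
    obtain D D' where D: "D \<ge> 0" "D' \<ge> 0"
      "\<And>h r. h \<in> carrier G \<Longrightarrow> r \<le> \<chi> h - D \<Longrightarrow> conn_above r h (h \<otimes> a)"
      "\<And>h r. h \<in> carrier G \<Longrightarrow> r \<le> \<chi> h - D' \<Longrightarrow> conn_above r h (h \<otimes> b)"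
      using eng.IH by blast
    \<comment> \<open>The path for \<open>b\<close> starts at \<open>h \<otimes> a\<close>, possibly
      \<open>\<bar>\<chi> a\<bar>\<close> lower than \<open>h\<close>; hence this summand besides
      the two dips.\<close>
    show ?case
    proof (intro exI[of _ "D + D' + \<bar>\<chi> a\<bar>"] conjI ballI allI impI)
      fix h r assume h: "h \<in> carrier G" and r: "r \<le> \<chi> h - (D + D' + \<bar>\<chi> a\<bar>)"
      have "conn_above r h (h \<otimes> a)" using h r D(1,2) by (intro D) auto
      also have "conn_above r (h \<otimes> a) (h \<otimes> a \<otimes> b)"
        using h r D(1,2) ab by (intro D) (auto simp: char_mult)
      finally show "conn_above r h (h \<otimes> (a \<otimes> b))" using h ab by (simp add: m_assoc)
    qed (use D in auto)
  qed
  then have "\<exists>D. \<forall>h\<in>carrier G. \<forall>r\<le>\<chi> h - D. conn_above r h (h \<otimes> g)"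
    using assms generate_gens by metis
  then obtain D where "\<forall>h\<in>carrier G. \<forall>r\<le>\<chi> h - D. conn_above r h (h \<otimes> g)" ..
  then show thesis using that[of D] by simp
qed

text \<open>All powers share one \<open>D\<close>: each copy of the path for \<open>x\<close> starts
  at least as high as the previous one, since \<open>\<chi> x \<ge> 0\<close>.\<close>

lemma conn_above_pow:
  assumes x: "x \<in> carrier G" "\<chi> x \<ge> 0"
  obtains D where
    "\<And>h r (n::nat). h \<in> carrier G \<Longrightarrow> r \<le> \<chi> h - D \<Longrightarrow> conn_above r h (h \<otimes> x [^] n)"
proof -
  obtain D where D: "\<And>h r. h \<in> carrier G \<Longrightarrow> r \<le> \<chi> h - D \<Longrightarrow> conn_above r h (h \<otimes> x)"
    using conn_above_mult[OF x(1)] by blast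
  have "conn_above r h (h \<otimes> x [^] n)" if "h \<in> carrier G" "r \<le> \<chi> h - D" for h r and n :: nat
  proof (induction n)
    case (Suc n)
    have "r \<le> \<chi> h + real n * \<chi> x - D" using that x by (smt (verit) mult_nonneg_nonneg of_nat_0_le_iff)
    then have "conn_above r (h \<otimes> x [^] n) (h \<otimes> x [^] n \<otimes> x)"
      using that x by (intro D) (simp_all add: char_mult add_increasing2 add_diff_eq[symmetric])
    from conn_above_trans[OF Suc this] show ?case
      using that x by (simp add: m_assoc)
  qed (use that in simp)
  with that show thesis by blast
qed

section \<open>Ends of rays and the elements that fix them\<close>

text \<open>The rays from \<open>g\<close> in direction \<open>x\<close> and from \<open>h\<close> in direction \<open>y\<close> define the same end of the
  filtration by the half spaces \<open>{\<chi> \<ge> R}\<close>, as \<open>R\<close> tends to infinity.\<close>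

definition ray_eq :: "'a \<Rightarrow> 'a \<Rightarrow> 'a \<Rightarrow> 'a \<Rightarrow> bool" where
  "ray_eq g x h y \<longleftrightarrow> (\<forall>R. \<exists>K. \<forall>k\<ge>K. \<forall>l\<ge>K. conn_above R (g \<otimes> x [^] (k::nat)) (h \<otimes> y [^] (l::nat)))"

lemma ray_eq_sym: "ray_eq g x h y \<Longrightarrow> ray_eq h y g x"
  unfolding ray_eq_def by (metis conn_above_sym)

lemma ray_eq_trans [trans]:
  assumes "ray_eq g x h y" "ray_eq h y k z"
  shows "ray_eq g x k z"
  unfolding ray_eq_def
proof
  fix R
  obtain K :: nat where K: "\<And>k l. k \<ge> K \<Longrightarrow> l \<ge> K \<Longrightarrow> conn_above R (g \<otimes> x [^] k) (h \<otimes> y [^] (l::nat))"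
    using assms(1) unfolding ray_eq_def by blast
  obtain L :: nat where L: "\<And>k' l. k' \<ge> L \<Longrightarrow> l \<ge> L \<Longrightarrow> conn_above R (h \<otimes> y [^] k') (k \<otimes> z [^] (l::nat))"
    using assms(2) unfolding ray_eq_def by blast
  show "\<exists>N. \<forall>n\<ge>N. \<forall>m\<ge>N. conn_above R (g \<otimes> x [^] (n::nat)) (k \<otimes> z [^] (m::nat))"
    using conn_above_trans[OF K L, of _ "max K L"] by (intro exI[of _ "max K L"]) auto
qed

lemma ray_eq_translate:
  assumes "ray_eq g x h y" "f \<in> carrier G" "g \<in> carrier G" "h \<in> carrier G"
    "x \<in> carrier G" "y \<in> carrier G"
  shows "ray_eq (f \<otimes> g) x (f \<otimes> h) y"
  unfolding ray_eq_def
proof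
  fix R
  obtain K :: nat where K:
    "\<And>k l. k \<ge> K \<Longrightarrow> l \<ge> K \<Longrightarrow> conn_above (R - \<chi> f) (g \<otimes> x [^] k) (h \<otimes> y [^] (l::nat))"
    using assms(1) unfolding ray_eq_def by blast
  show "\<exists>K. \<forall>k\<ge>K. \<forall>l\<ge>K.
      conn_above R (f \<otimes> g \<otimes> x [^] (k::nat)) (f \<otimes> h \<otimes> y [^] (l::nat))"
    using conn_above_translate[OF K assms(2)] assms(2-)
    by (intro exI[of _ K]) (auto simp: m_assoc)
qed

text \<open>The corner \<open>x^k y^l = y^l x^k\<close> links the two rays: it is reached from
  \<open>x^k\<close> along \<open>y\<close> and from \<open>y^l\<close> along \<open>x\<close>. Both
  dips are bounded, so for large exponents the paths stay above \<open>R\<close>.\<close>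

lemma ray_eq_commuting:
  assumes x: "x \<in> carrier G" "\<chi> x > 0" and y: "y \<in> carrier G" "\<chi> y > 0"
    and xy: "x \<otimes> y = y \<otimes> x"
  shows "ray_eq \<one> x \<one> y"
  unfolding ray_eq_def
proof
  fix R
  obtain D where D:
    "\<And>h r (n::nat). h \<in> carrier G \<Longrightarrow> r \<le> \<chi> h - D \<Longrightarrow> conn_above r h (h \<otimes> x [^] n)"
    using conn_above_pow[of x] x by auto
  obtain D' where D':
    "\<And>h r (n::nat). h \<in> carrier G \<Longrightarrow> r \<le> \<chi> h - D' \<Longrightarrow> conn_above r h (h \<otimes> y [^] n)"
    using conn_above_pow[of y] y by auto
  obtain K :: nat where K: "\<And>k. k \<ge> K \<Longrightarrow> R + D' \<le> real k * \<chi> x"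
    using ex_nat_above x by meson
  obtain L :: nat where L: "\<And>k. k \<ge> L \<Longrightarrow> R + D \<le> real k * \<chi> y"
    using ex_nat_above y by meson
  have "conn_above R (x [^] k) (y [^] l)" if kl: "k \<ge> max K L" "l \<ge> max K L" for k l :: nat
  proof -
    have "y \<otimes> x [^] k = x [^] k \<otimes> y"
      using group_commutes_pow[OF xy x(1) y(1)] by simp
    then have comm: "x [^] k \<otimes> y [^] l = y [^] l \<otimes> x [^] k"
      using x y group_commutes_pow[of y "x [^] k" l] by simp
    have "conn_above R (x [^] k) (x [^] k \<otimes> y [^] l)"
      using x K[of k] kl by (intro D') auto
    also have "conn_above R (x [^] k \<otimes> y [^] l) (y [^] l)"
      unfolding comm using y L[of l] kl by (intro conn_above_sym[OF D]) auto
    finally show ?thesis .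
  qed
  then show "\<exists>K. \<forall>k\<ge>K. \<forall>l\<ge>K. conn_above R (\<one> \<otimes> x [^] (k::nat)) (\<one> \<otimes> y [^] (l::nat))"
    using x y by (intro exI[of _ "max K L"]) auto
qed

lemma ray_eq_pos_commuting:
  assumes "x \<in> carrier G" "y \<in> carrier G" "\<chi> x \<noteq> 0" "\<chi> y \<noteq> 0" "x \<otimes> y = y \<otimes> x"
  shows "ray_eq \<one> (pos x) \<one> (pos y)"
proof (rule ray_eq_commuting)
  have "pos y \<otimes> x = x \<otimes> pos y" using pos_commute assms by simp
  then show "pos x \<otimes> pos y = pos y \<otimes> pos x"
    using pos_commute[of "pos y" x] assms by (simp add: pos_closed)
qed (use assms in \<open>simp_all add: pos_closed char_pos\<close>)

text \<open>Since \<open>g x^k = x^k g\<close>, the path spelling \<open>g\<close> joins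
  \<open>x^k\<close> to \<open>g x^k\<close>, and its bounded dip is outweighed by the height of
  \<open>x^k\<close>.\<close>

lemma ray_eq_centralizer:
  assumes x: "x \<in> carrier G" "\<chi> x > 0" and g: "g \<in> carrier G" and gx: "g \<otimes> x = x \<otimes> g"
  shows "ray_eq g x \<one> x"
proof -
  \<comment> \<open>It is enough to compare equal exponents: the ray of \<open>x\<close> is
    equivalent to itself, which absorbs a change of exponent.\<close>
  have "ray_eq g x \<one> x" if *: "\<forall>R. \<exists>K. \<forall>k\<ge>K. conn_above R (g \<otimes> x [^] k) (x [^] (k::nat))"
    unfolding ray_eq_def
  proof
    fix R
    obtain K :: nat where K: "\<And>k. k \<ge> K \<Longrightarrow> conn_above R (g \<otimes> x [^] k) (x [^] k)"
      using * by blast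
    obtain L :: nat where L: "\<And>k l. k \<ge> L \<Longrightarrow> l \<ge> L \<Longrightarrow> conn_above R (\<one> \<otimes> x [^] k) (\<one> \<otimes> x [^] (l::nat))"
      using ray_eq_commuting[OF x x refl] unfolding ray_eq_def by blast
    show "\<exists>K. \<forall>k\<ge>K. \<forall>l\<ge>K. conn_above R (g \<otimes> x [^] (k::nat)) (\<one> \<otimes> x [^] (l::nat))"
      using conn_above_trans[OF K L[unfolded l_one[OF nat_pow_closed[OF x(1)]]]] x
      by (intro exI[of _ "max K L"]) auto
  qed
  moreover have "\<exists>K. \<forall>k\<ge>K. conn_above R (g \<otimes> x [^] k) (x [^] (k::nat))" for R
  proof -
    obtain D where D: "\<And>h r. h \<in> carrier G \<Longrightarrow> r \<le> \<chi> h - D \<Longrightarrow> conn_above r h (h \<otimes> g)"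
      using conn_above_mult[OF g] by blast
    obtain K :: nat where K: "\<And>k. k \<ge> K \<Longrightarrow> R + D \<le> real k * \<chi> x"
      using ex_nat_above x by meson
    have "conn_above R (g \<otimes> x [^] k) (x [^] k)" if "k \<ge> K" for k :: nat
    proof -
      have "g \<otimes> x [^] k = x [^] k \<otimes> g"
        using group_commutes_pow[OF gx[symmetric] x(1) g] by simp
      then show ?thesis
        using x K[OF that] D[of "x [^] k" R] by (simp add: conn_above_sym)
    qed
    then show ?thesis by blast
  qed
  ultimately show ?thesis by blast
qed

text \<open>The elements fixing the end of \<open>t\<close> form a subgroup, which is the whole
  group once it contains \<open>X\<close>. \<open>X\<close> and \<open>Y\<close> are kept apart: the
  end is tested on the Artin generators, while the Cayley graph may use others.\<close>

lemma connected_if_ray_fixed: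
  assumes t: "t \<in> carrier G" "\<chi> t > 0"
    and X: "X \<subseteq> carrier G" "generate G X = carrier G"
    and fixed: "\<And>x. x \<in> X \<Longrightarrow> ray_eq x t \<one> t"
  shows "connected_graph (full_subgraph (cayley_graph G Y) (nonneg_part G \<chi>))"
proof -
  have inv_fixed: "ray_eq (inv g) t \<one> t" if "g \<in> carrier G" "ray_eq g t \<one> t" for g
    using ray_eq_sym[OF ray_eq_translate[OF that(2), of "inv g"]] that t by simp
  have fixed': "ray_eq g t \<one> t" if "g \<in> generate G X" for g
    using that
  proof (induction rule: generate.induct)
    case one
    show ?case using ray_eq_commuting[OF t t] by simp
  next
    case (incl h)
    then show ?case by (rule fixed)
  next
    case (inv h)
    then show ?case using X fixed inv_fixed by blast
  next
    case (eng g h)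
    then have gh: "g \<in> carrier G" "h \<in> carrier G" using X by auto
    have "ray_eq (g \<otimes> h) t (g \<otimes> \<one>) t"
      using eng gh t by (intro ray_eq_translate) auto
    then show ?case using ray_eq_trans eng.IH(1) gh by simp
  qed
  \<comment> \<open>A path along powers of \<open>t\<close> may dip below height 0. Some generator
    in \<open>Y\<close> has nonzero character; it or its inverse climbs edge by edge without any
    dip.\<close>
  have "\<exists>y\<in>Y. \<chi> y \<noteq> 0"
  proof (rule ccontr)
    assume *: "\<not> ?thesis"
    have "\<chi> g = 0" if "g \<in> generate G Y" for g
      using that
    proof (induction rule: generate.induct)
      case (eng g h)
      then show ?case using generate_gens by (simp add: char_mult)
    qed (use * gens_closed in auto)
    then show False using t generate_gens by auto
  qed
  then obtain y where y: "y \<in> Y" "\<chi> y \<noteq> 0" by blast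
  have yG: "y \<in> carrier G" using y gens_closed by blast
  define s where "s = pos y"
  have s: "s \<in> carrier G" "\<chi> s > 0" using y yG by (auto simp: s_def pos_closed char_pos)
  have s_step: "conn_above 0 h (h \<otimes> s)" if "h \<in> carrier G" "\<chi> h \<ge> 0" for h
    using conn_above_generator[OF y(1) that(1)] conn_above_generator_inv[OF y(1) that(1)] that y
    by (auto simp: s_def pos_def)
  have s_pow: "conn_above 0 h (h \<otimes> s [^] n)" if "h \<in> carrier G" "\<chi> h \<ge> 0" for h and n :: nat
  proof (induction n)
    case (Suc n)
    have "0 \<le> real n * \<chi> s" using s by simp
    then have "conn_above 0 (h \<otimes> s [^] n) (h \<otimes> s [^] n \<otimes> s)"
      using that s by (intro s_step) (auto simp: char_mult)
    from conn_above_trans[OF Suc this] show ?case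
      using that s by (simp add: m_assoc)
  qed (use that in simp)
  obtain D where D:
    "\<And>h r (n::nat). h \<in> carrier G \<Longrightarrow> r \<le> \<chi> h - D \<Longrightarrow> conn_above r h (h \<otimes> t [^] n)"
    using conn_above_pow[of t] t by auto
  \<comment> \<open>From a start at height at least 0, \<open>k\<close> steps along \<open>s\<close>
    lead to height at least \<open>D\<close>, which pays for the dip of all powers of
    \<open>t\<close>.\<close>
  obtain k :: nat where k: "D \<le> real k * \<chi> s"
    using ex_nat_above s by blast
  have main: "\<exists>K. \<forall>l\<ge>K. conn_above 0 g (t [^] (l::nat))" if g: "g \<in> carrier G" "\<chi> g \<ge> 0" for g
  proof -
    have gs: "g \<otimes> s [^] k \<in> carrier G" using g s by simp
    obtain K where K: "\<And>l m. l \<ge> K \<Longrightarrow> m \<ge> K \<Longrightarrow>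
        conn_above 0 (g \<otimes> s [^] k \<otimes> t [^] l) (\<one> \<otimes> t [^] (m::nat))"
      using fixed'[of "g \<otimes> s [^] k"] gs X unfolding ray_eq_def by blast
    have "conn_above 0 g (t [^] l)" if "l \<ge> K" for l :: nat
    proof -
      have "conn_above 0 g (g \<otimes> s [^] k)" by (rule s_pow[OF g])
      also have "conn_above 0 (g \<otimes> s [^] k) (g \<otimes> s [^] k \<otimes> t [^] l)"
        using g s k gs by (intro D) (auto simp: char_mult)
      also have "conn_above 0 (g \<otimes> s [^] k \<otimes> t [^] l) (t [^] l)"
        using K[OF that that] t by simp
      finally show ?thesis .
    qed
    then show ?thesis by blast
  qed
  show ?thesis
    unfolding connected_nonneg_part_iff
  proof (intro ballI)
    fix g h assume "g \<in> nonneg_part G \<chi>" "h \<in> nonneg_part G \<chi>"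
    then obtain K L where "\<forall>l\<ge>K. conn_above 0 g (t [^] (l::nat))" "\<forall>l\<ge>L. conn_above 0 h (t [^] (l::nat))"
      using main[of g] main[of h] unfolding nonneg_part_def by auto
    then have "conn_above 0 g (t [^] max K L)" "conn_above 0 h (t [^] max K L)"
      by simp_all
    then show "conn_above 0 g h"
      by (rule conn_above_trans[OF _ conn_above_sym])
  qed
qed

end


section \<open>Actions by affine maps on functions\<close>

text \<open>The affine group over a Novikov ring is modelled by its action on all functions on the real
  line: multiplication by the group element of character value \<open>r\<close> is translation by \<open>r\<close>.\<close>

definition affine_map :: "real \<Rightarrow> ((real \<Rightarrow> complex) \<Rightarrow> real \<Rightarrow> complex) \<Rightarrow> bool" where
  "affine_map r F \<longleftrightarrow>
     (\<exists>m d C. m \<noteq> 0 \<and> (\<forall>f x. F f x = m * f (x - r) + d x) \<and> (\<forall>x<C. d x = 0))"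

lemma affine_map_id: "affine_map 0 id"
  unfolding affine_map_def by (intro exI[of _ 1] exI[of _ "\<lambda>_. 0"]) auto

lemma affine_map_comp:
  assumes "affine_map r F" "affine_map s F'"
  shows "affine_map (r + s) (F \<circ> F')"
proof -
  obtain m d C where F: "m \<noteq> 0" "\<And>f x. F f x = m * f (x - r) + d x" "\<And>x. x < C \<Longrightarrow> d x = 0"
    using assms(1) unfolding affine_map_def by blast
  obtain m' d' C' where F': "m' \<noteq> 0" "\<And>f x. F' f x = m' * f (x - s) + d' x"
    "\<And>x. x < C' \<Longrightarrow> d' x = 0"
    using assms(2) unfolding affine_map_def by blast
  show ?thesis
    unfolding affine_map_def
    by (intro exI[of _ "m * m'"] exI[of _ "\<lambda>x. m * d' (x - r) + d x"] exI[of _ "min C (C' + r)"])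
      (use F F' in \<open>auto simp: algebra_simps\<close>)
qed

lemma affine_map_right_inverse:
  assumes "affine_map r F" "F \<circ> F' = id"
  shows "affine_map (- r) F'"
proof -
  obtain m d C where F: "m \<noteq> 0" "\<And>f x. F f x = m * f (x - r) + d x" "\<And>x. x < C \<Longrightarrow> d x = 0"
    using assms(1) unfolding affine_map_def by blast
  have "F' f x = inverse m * f (x + r) + - inverse m * d (x + r)" for f x
  proof -
    have "f (x + r) = F (F' f) (x + r)" using assms(2) by (metis comp_apply id_apply)
    also have "\<dots> = m * F' f x + d (x + r)" by (simp add: F)
    finally show ?thesis using F(1) by (simp add: field_simps)
  qed
  then show ?thesis
    unfolding affine_map_def
    by (intro exI[of _ "inverse m"] exI[of _ "\<lambda>x. - inverse m * d (x + r)"] exI[of _ "C - r"])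
      (use F in auto)
qed

lemma affine_map_bij:
  assumes "affine_map r F"
  shows "bij F"
proof -
  obtain m d C where F: "m \<noteq> 0" "\<And>f x. F f x = m * f (x - r) + d x" "\<And>x. x < C \<Longrightarrow> d x = 0"
    using assms unfolding affine_map_def by blast
  let ?F' = "\<lambda>f x. (f (x + r) - d (x + r)) / m"
  have "F (?F' f) = f" "?F' (F f) = f" for f
    using F(1) by (auto simp: F(2))
  then show ?thesis by (intro o_bij[of ?F']) auto
qed

context generated_character
begin

text \<open>If the part of the Cayley graph above height 0 is connected, the images of the zero function
  under elements of nonnegative character have supports bounded below uniformly, since an edge at
  \<open>p\<close> changes the image only by a translate by \<open>\<chi> p\<close>. Conjugating by powers of \<open>a\<close> violates
  this bound.\<close>

lemma not_connected_if_affine_action: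
  fixes act :: "'a \<Rightarrow> (real \<Rightarrow> complex) \<Rightarrow> real \<Rightarrow> complex"
  assumes act_one: "act \<one> = id"
    and act_mult: "\<And>g h. \<lbrakk>g \<in> carrier G; h \<in> carrier G\<rbrakk> \<Longrightarrow> act (g \<otimes> h) = act g \<circ> act h"
    and X: "X \<subseteq> carrier G" "generate G X = carrier G"
    and affine_gen: "\<And>x. x \<in> X \<Longrightarrow> affine_map (\<chi> x) (act x)"
    and fin: "finite Y"
    and a: "a \<in> carrier G" "\<chi> a \<noteq> 0" "act a (\<lambda>_. 0) = (\<lambda>_. 0)"
    and b: "b \<in> carrier G" "act b (\<lambda>_. 0) \<noteq> (\<lambda>_. 0)"
  shows "\<not> connected_graph (full_subgraph (cayley_graph G Y) (nonneg_part G \<chi>))"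
proof
  assume conn: "connected_graph (full_subgraph (cayley_graph G Y) (nonneg_part G \<chi>))"
  let ?z = "\<lambda>_. 0 :: complex"
  have inv_act: "act (inv g) \<circ> act g = id" "act g \<circ> act (inv g) = id" if "g \<in> carrier G" for g
    using that act_mult[of "inv g" g] act_mult[of g "inv g"] act_one by auto
  have affine: "affine_map (\<chi> g) (act g)" if "g \<in> generate G X" for g
    using that
  proof (induction rule: generate.induct)
    case one
    show ?case unfolding char_one act_one by (rule affine_map_id)
  next
    case (incl h)
    then show ?case by (rule affine_gen)
  next
    case (inv h)
    then show ?case
      using affine_map_right_inverse[OF affine_gen inv_act(2)] X by auto
  next
    case (eng g h)
    then have "g \<in> carrier G" "h \<in> carrier G" using X by auto
    then show ?case
      unfolding act_mult[OF \<open>g \<in> carrier G\<close> \<open>h \<in> carrier G\<close>] char_mult[OF \<open>g \<in> carrier G\<close> \<open>h \<in> carrier G\<close>]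
      using affine_map_comp[OF eng.IH] by blast
  qed
  have affine': "\<exists>m. m \<noteq> 0 \<and> (\<forall>f x. act g f x = m * f (x - \<chi> g) + act g ?z x)"
    if "g \<in> carrier G" for g
  proof -
    have "affine_map (\<chi> g) (act g)" using affine that X(2) by simp
    then obtain m d where "m \<noteq> 0" and m: "\<And>f x. act g f x = m * f (x - \<chi> g) + d x"
      unfolding affine_map_def by blast
    moreover have "act g ?z x = d x" for x by (simp add: m)
    ultimately show ?thesis by auto
  qed
  have "\<exists>C. \<forall>x<C. act y ?z x = 0" if "y \<in> Y" for y
  proof -
    have "affine_map (\<chi> y) (act y)" using affine that X(2) gens_closed by auto
    then obtain m d C where "\<And>f x. act y f x = m * f (x - \<chi> y) + d x" "\<And>x. x < C \<Longrightarrow> d x = 0"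
      unfolding affine_map_def by blast
    then show ?thesis by auto
  qed
  then obtain Cy where Cy: "\<And>y x. y \<in> Y \<Longrightarrow> x < Cy y \<Longrightarrow> act y ?z x = 0" by metis
  define C where "C = Min (insert 0 (Cy ` Y))"
  have C_le: "C \<le> 0" "\<And>y. y \<in> Y \<Longrightarrow> C \<le> Cy y" using fin by (auto simp: C_def)
  have edge: "act (p \<otimes> y) ?z x = act p ?z x"
    if p: "p \<in> carrier G" and y: "y \<in> Y" and "0 \<le> \<chi> p" "x < C" for p y x
  proof -
    obtain m where m: "\<And>f x. act p f x = m * f (x - \<chi> p) + act p ?z x"
      using affine'[OF p] by blast
    have "act (p \<otimes> y) ?z x = act p (act y ?z) x"
      using p y gens_closed by (simp add: act_mult subset_iff)
    also have "\<dots> = m * act y ?z (x - \<chi> p) + act p ?z x" by (rule m)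
    also have "act y ?z (x - \<chi> p) = 0"
      using that C_le(2)[OF y] by (intro Cy[OF y]) simp
    finally show ?thesis by simp
  qed
  have bounded: "act g ?z x = 0" if "g \<in> nonneg_part G \<chi>" "x < C" for g x
  proof -
    have "conn_above 0 \<one> g"
      using conn that unfolding connected_nonneg_part_iff by (simp add: nonneg_part_def)
    then show ?thesis unfolding conn_above_def
    proof (induction rule: rtrancl_induct)
      case base
      then show ?case by (simp add: act_one)
    next
      case (step h k)
      then obtain p y where "{h, k} = {p, p \<otimes> y}" "p \<in> carrier G" "y \<in> Y"
        by (auto simp: step_above_def cayley_graph_def)
      then show ?case
        using edge[of p y x] step that
        by (auto simp: step_above_def doubleton_eq_iff)
    qed
  qed
  define t where "t = pos a"
  have "act (inv a) ?z = ?z" using inv_act(1)[OF a(1)] a(3) by (metis comp_apply id_apply)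
  then have t: "t \<in> carrier G" "\<chi> t > 0" "act (inv t) ?z = ?z" "act t ?z = ?z"
    using a by (auto simp: t_def pos_def)
  have pow_fix: "act (s [^] n) ?z = ?z" if "s \<in> carrier G" "act s ?z = ?z" for s and n :: nat
    using that by (induction n) (auto simp: act_one act_mult)
  obtain x0 where x0: "act b ?z x0 \<noteq> 0" using b(2) by blast
  \<comment> \<open>The offending element will be \<open>t^(-k) b t^l\<close>. The factor
    \<open>t^l\<close> fixes 0 and serves to make the character nonnegative; \<open>t^(-k)\<close>
    moves the support point \<open>x0\<close> of the image of 0 under \<open>b\<close> to
    \<open>x0 - k * \<chi> t\<close>, which lies below \<open>C\<close>.\<close>
  obtain k :: nat where k: "x0 - C < real k * \<chi> t"
    using reals_Archimedean3[OF t(2)] by blast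
  obtain l :: nat where l: "real k * \<chi> t - \<chi> b < real l * \<chi> t"
    using reals_Archimedean3[OF t(2)] by blast
  let ?s = "inv t [^] k"
  let ?g = "?s \<otimes> (b \<otimes> t [^] l)"
  have s: "?s \<in> carrier G" "\<chi> ?s = - (real k * \<chi> t)" using t by auto
  have "?g \<in> nonneg_part G \<chi>"
    using b t s l by (simp add: nonneg_part_def char_mult)
  moreover obtain m where m: "m \<noteq> 0" "\<And>f x. act ?s f x = m * f (x - \<chi> ?s) + act ?s ?z x"
    using affine'[OF s(1)] by blast
  have "act ?g ?z = act ?s (act b ?z)"
    using b t s by (simp add: act_mult pow_fix)
  then have "act ?g ?z (x0 - real k * \<chi> t) = m * act b ?z x0"
    using m(2)[of "act b ?z" "x0 - real k * \<chi> t"] t s by (simp add: pow_fix)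
  ultimately show False
    using bounded[of ?g "x0 - real k * \<chi> t"] k x0 m(1) by simp
qed

end


section \<open>Actions of presented groups\<close>

definition word_action :: "('a \<Rightarrow> 'b \<Rightarrow> 'b) \<Rightarrow> 'a word \<Rightarrow> 'b \<Rightarrow> 'b" where
  "word_action \<phi> w = foldr (\<lambda>(s, b) F. (if b then \<phi> s else inv_into UNIV (\<phi> s)) \<circ> F) w id"

lemma word_action_Nil [simp]: "word_action \<phi> [] = id"
  by (simp add: word_action_def)

lemma word_action_Cons [simp]:
  "word_action \<phi> ((s, b) # w) = (if b then \<phi> s else inv_into UNIV (\<phi> s)) \<circ> word_action \<phi> w"
  by (simp add: word_action_def)

lemma word_action_append: "word_action \<phi> (u @ v) = word_action \<phi> u \<circ> word_action \<phi> v"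
  by (induction u) (auto simp: comp_assoc)

lemma word_action_word_eq:
  assumes bij: "\<And>s. s \<in> S \<Longrightarrow> bij (\<phi> s)"
    and rel: "\<And>u v. (u, v) \<in> R \<Longrightarrow> word_action \<phi> u = word_action \<phi> v"
    and "word_eq S R u v"
  shows "word_action \<phi> u = word_action \<phi> v"
  using assms(3)
proof (induction rule: word_eq.induct)
  case (weq_cancel s b)
  have "\<phi> s \<circ> inv_into UNIV (\<phi> s) = id" "inv_into UNIV (\<phi> s) \<circ> \<phi> s = id"
    using bij[OF weq_cancel] by (auto simp: bij_is_surj bij_is_inj surj_iff[symmetric] inj_iff[symmetric])
  then show ?case by (cases b) auto
qed (auto simp: word_action_append rel)

lemma presented_group_action:
  assumes bij: "\<And>s. s \<in> S \<Longrightarrow> bij (\<phi> s)"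
    and rel: "\<And>u v. (u, v) \<in> R \<Longrightarrow> word_action \<phi> u = word_action \<phi> v"
  obtains act where "act \<one>\<^bsub>presented_group S R\<^esub> = id"
    and "\<And>g h. \<lbrakk>g \<in> carrier (presented_group S R); h \<in> carrier (presented_group S R)\<rbrakk> \<Longrightarrow>
      act (g \<otimes>\<^bsub>presented_group S R\<^esub> h) = act g \<circ> act h"
    and "\<And>s. s \<in> S \<Longrightarrow> act (presented_gen S R s) = \<phi> s"
proof -
  \<comment> \<open>A group element is a class of words; any chosen member will do, as equivalent
    words act equally.\<close>
  define act where "act g = word_action \<phi> (SOME w. w \<in> g)" for g
  have act: "act (word_rel S R `` {w}) = word_action \<phi> w" if "w \<in> words S" for w
  proof -
    have "w \<in> word_rel S R `` {w}"
      using that by (auto simp: word_rel_def intro: word_eq.weq_refl)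
    then have "(SOME w'. w' \<in> word_rel S R `` {w}) \<in> word_rel S R `` {w}"
      by (metis someI)
    then have "word_eq S R w (SOME w'. w' \<in> word_rel S R `` {w})"
      by (simp add: word_rel_def)
    then show ?thesis
      unfolding act_def using word_action_word_eq[of S \<phi> R] bij rel by metis
  qed
  show thesis
  proof (rule that)
    show "act \<one>\<^bsub>presented_group S R\<^esub> = id"
      using act[of "[]"] by (simp add: presented_group_def words_def)
    show "act (presented_gen S R s) = \<phi> s" if "s \<in> S" for s
      using act[of "[(s, True)]"] that by (simp add: presented_gen_def words_def)
    fix g h assume "g \<in> carrier (presented_group S R)" "h \<in> carrier (presented_group S R)"
    then obtain u v where uv: "u \<in> words S" "v \<in> words S"
      "g = word_rel S R `` {u}" "h = word_rel S R `` {v}"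
      by (auto simp: presented_group_def quotient_def)
    then have "u @ v \<in> words S" by (auto simp: words_def)
    then show "act (g \<otimes>\<^bsub>presented_group S R\<^esub> h) = act g \<circ> act h"
      unfolding uv(3,4) presented_mult[OF uv(1,2)] act[OF uv(1)] act[OF uv(2)]
      by (simp add: act word_action_append)
  qed
qed

lemma word_action_alternating:
  "word_action \<phi> (alternating u v (2 * n)) = (\<phi> u \<circ> \<phi> v) ^^ n"
  by (induction n) (auto simp: comp_assoc)

text \<open>With an even label \<open>2n\<close>, both sides of the relator are \<open>n\<close>-th
  powers, so the relation reads \<open>(uv)^n = (vu)^n\<close>.\<close>

lemma artin_group_action:
  assumes bij: "\<And>v. v \<in> verts \<Gamma> \<Longrightarrow> bij (\<phi> v)"
    and even: "\<And>e. e \<in> edges \<Gamma> \<Longrightarrow> even (label \<Gamma> e)"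
    and rel: "\<And>u v. {u, v} \<in> edges \<Gamma> \<Longrightarrow>
      (\<phi> u \<circ> \<phi> v) ^^ (label \<Gamma> {u, v} div 2) = (\<phi> v \<circ> \<phi> u) ^^ (label \<Gamma> {u, v} div 2)"
  obtains act where "act \<one>\<^bsub>artin_group \<Gamma>\<^esub> = id"
    and "\<And>g h. \<lbrakk>g \<in> carrier (artin_group \<Gamma>); h \<in> carrier (artin_group \<Gamma>)\<rbrakk> \<Longrightarrow>
      act (g \<otimes>\<^bsub>artin_group \<Gamma>\<^esub> h) = act g \<circ> act h"
    and "\<And>v. v \<in> verts \<Gamma> \<Longrightarrow> act (artin_gen \<Gamma> v) = \<phi> v"
proof -
  have "word_action \<phi> u = word_action \<phi> v" if "(u, v) \<in> artin_relators \<Gamma>" for u v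
  proof -
    obtain x y where xy: "{x, y} \<in> edges \<Gamma>"
      "u = alternating x y (label \<Gamma> {x, y})" "v = alternating y x (label \<Gamma> {x, y})"
      using \<open>(u, v) \<in> artin_relators \<Gamma>\<close> by (auto simp: artin_relators_def)
    have "label \<Gamma> {x, y} = 2 * (label \<Gamma> {x, y} div 2)"
      using even[OF xy(1)] by simp
    then show ?thesis using rel[OF xy(1)] xy word_action_alternating by metis
  qed
  from presented_group_action[of "verts \<Gamma>" \<phi> "artin_relators \<Gamma>", OF bij this] that
  show thesis unfolding artin_group_def artin_gen_def by blast
qed


section \<open>Forests\<close>

text \<open>Stated for a relation instead of a graph, so that it can be applied to a selection of
  edges; the list convention is that of \<open>closed_reduced_path\<close>.\<close>

definition has_cycle :: "'a set \<Rightarrow> ('a \<Rightarrow> 'a \<Rightarrow> bool) \<Rightarrow> bool" where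
  "has_cycle W adj \<longleftrightarrow> (\<exists>vs. 3 \<le> length vs \<and> distinct vs \<and> set vs \<subseteq> W \<and>
     (\<forall>i<length vs. adj (vs ! i) (vs ! (Suc i mod length vs))))"

text \<open>An end point of a longest path is a leaf: a second neighbour would either prolong the path
  or close a cycle.\<close>

lemma forest_leaf:
  assumes fin: "finite W" "W \<noteq> {}" and acyclic: "\<not> has_cycle W adj"
    and sym: "\<And>u v. adj u v \<Longrightarrow> adj v u" and irrefl: "\<And>u. \<not> adj u u"
  obtains v where "v \<in> W" "\<And>u u'. \<lbrakk>u \<in> W; u' \<in> W; adj v u; adj v u'\<rbrakk> \<Longrightarrow> u = u'"
proof -
  define P where "P vs \<longleftrightarrow> vs \<noteq> [] \<and> distinct vs \<and> set vs \<subseteq> W \<and>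
    (\<forall>i. Suc i < length vs \<longrightarrow> adj (vs ! i) (vs ! Suc i))" for vs
  obtain w where "w \<in> W" using fin by blast
  then have "P [w]" by (simp add: P_def)
  moreover have "length vs \<le> card W" if "P vs" for vs
    using that fin distinct_card[of vs] card_mono[of W "set vs"] by (auto simp: P_def)
  ultimately obtain vs where vs: "P vs" and longest: "\<And>vs'. P vs' \<Longrightarrow> length vs' \<le> length vs"
    using ex_has_greatest_nat[of P "[w]" length "Suc (card W)"] by (auto simp: le_imp_less_Suc)
  have second: "1 < length vs \<and> u = vs ! 1" if u: "u \<in> W" "adj (hd vs) u" for u
  proof -
    have hd: "hd vs = vs ! 0" using vs by (simp add: P_def hd_conv_nth)
    have "u \<in> set vs"
    proof (rule ccontr)
      assume "u \<notin> set vs"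
      then have "P (u # vs)"
        using vs u sym hd by (auto simp: P_def nth_Cons split: nat.split)
      then show False using longest by fastforce
    qed
    then obtain i where i: "i < length vs" "u = vs ! i" by (auto simp: in_set_conv_nth)
    have "i \<noteq> 0" using irrefl u(2) i hd by metis
    moreover have "\<not> 2 \<le> i"
    proof
      assume "2 \<le> i"
      \<comment> \<open>The edge from the head to \<open>u = vs ! i\<close> closes this initial
        segment to a cycle, with at least three vertices as \<open>2 \<le> i\<close>.\<close>
      let ?c = "take (Suc i) vs"
      have "adj (?c ! j) (?c ! (Suc j mod length ?c))" if "j < length ?c" for j
        using that i vs u(2) hd sym by (cases "j = i") (auto simp: P_def)
      moreover have "3 \<le> length ?c" "distinct ?c" "set ?c \<subseteq> W"
        using \<open>2 \<le> i\<close> i vs set_take_subset[of "Suc i" vs] by (auto simp: P_def)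
      ultimately show False using acyclic unfolding has_cycle_def by blast
    qed
    ultimately show ?thesis using i by (cases "i = 1") auto
  qed
  show thesis
    by (rule that[of "hd vs"]) (use vs second in \<open>auto simp: P_def\<close>)
qed

text \<open>Induction by removing a leaf: its value is involved in the equation of at most one edge,
  which can be solved as all other values are nonzero.\<close>

lemma forest_edge_products:
  fixes \<omega> :: "'a \<Rightarrow> 'a \<Rightarrow> 'b :: field"
  assumes fin: "finite W" and acyclic: "\<not> has_cycle W adj"
    and sym: "\<And>u v. adj u v \<Longrightarrow> adj v u" and irrefl: "\<And>u. \<not> adj u u"
    and \<omega>: "\<And>u v. \<omega> u v \<noteq> 0" "\<And>u v. \<omega> u v = \<omega> v u"
  shows "\<exists>c. (\<forall>v. c v \<noteq> 0) \<and> (\<forall>u\<in>W. \<forall>v\<in>W. adj u v \<longrightarrow> c u * c v = \<omega> u v)"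
  using fin acyclic
proof (induction W rule: finite_psubset_induct)
  case (psubset W)
  show ?case
  proof (cases "W = {}")
    case True
    then show ?thesis by (intro exI[of _ "\<lambda>_. 1"]) auto
  next
    case False
    obtain v where v: "v \<in> W" "\<And>u u'. \<lbrakk>u \<in> W; u' \<in> W; adj v u; adj v u'\<rbrakk> \<Longrightarrow> u = u'"
      using forest_leaf[OF psubset.hyps False psubset.prems sym irrefl] by blast
    have "\<not> has_cycle (W - {v}) adj"
      using psubset.prems unfolding has_cycle_def by (meson Diff_subset order_trans)
    then obtain c where c: "\<And>u. c u \<noteq> 0"
      "\<And>u w. \<lbrakk>u \<in> W - {v}; w \<in> W - {v}; adj u w\<rbrakk> \<Longrightarrow> c u * c w = \<omega> u w"
      using psubset.IH[of "W - {v}"] v(1) by blast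
    show ?thesis
    proof (cases "\<exists>w\<in>W. adj v w")
      case False
      then have "c u * c w = \<omega> u w" if "u \<in> W" "w \<in> W" "adj u w" for u w
        using that c(2)[of u w] sym by blast
      then show ?thesis using c(1) by blast
    next
      case True
      then obtain w where w: "w \<in> W" "adj v w" by blast
      define c' where "c' = c(v := \<omega> v w / c w)"
      have wv: "w \<noteq> v" using w irrefl by auto
      have "c' u \<noteq> 0" for u using c(1) \<omega>(1) by (simp add: c'_def)
      moreover have "c' x * c' y = \<omega> x y" if xy: "x \<in> W" "y \<in> W" "adj x y" for x y
      proof -
        have ne: "x \<noteq> y" using xy irrefl by auto
        consider "x = v" | "y = v" | "x \<noteq> v" "y \<noteq> v" by blast
        then show ?thesis
        proof cases
          case 1
          then have "y = w" using v(2) w xy by blast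
          then show ?thesis using 1 wv c(1) by (simp add: c'_def)
        next
          case 2
          then have "x = w" using v(2) w xy sym by blast
          then show ?thesis using 2 wv c(1) \<omega>(2)[of v w] by (simp add: c'_def)
        next
          case 3
          then show ?thesis using c(2) xy by (simp add: c'_def)
        qed
      qed
      ultimately show ?thesis by blast
    qed
  qed
qed

lemma alternating_cycle_even:
  assumes "n > 0" and "\<And>i. i < n \<Longrightarrow> P (Suc i mod n) \<longleftrightarrow> \<not> P i"
  shows "even (n::nat)"
proof -
  have flip: "P i \<longleftrightarrow> (P 0 \<longleftrightarrow> even i)" if "i < n" for i
    using that
  proof (induction i)
    case (Suc i)
    then show ?case using assms(2)[of i] by auto
  qed simp
  have "P 0 \<longleftrightarrow> \<not> P (n - 1)" using assms(1) assms(2)[of "n - 1"] by simp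
  then have "odd (n - 1)" using flip[of "n - 1"] assms(1) by auto
  then show ?thesis by (cases n) auto
qed


section \<open>Even Artin groups\<close>

text \<open>At each point this is an affine map of the field with factor
  \<open>\<omega> \<noteq> 1\<close>. It fixes \<open>k x / (1 - \<omega>)\<close> and multiplies
  the difference from it by \<open>\<omega>\<close>, so its order divides \<open>n\<close>.\<close>

lemma root_of_unity_map_pow:
  fixes F :: "('a \<Rightarrow> 'b :: field) \<Rightarrow> 'a \<Rightarrow> 'b"
  assumes "\<And>f x. F f x = \<omega> * f x + k x" "\<omega> \<noteq> 1" "\<omega> ^ n = 1"
  shows "F ^^ n = id"
proof -
  let ?q = "\<lambda>x. k x / (1 - \<omega>)"
  have q: "\<omega> * ?q x + k x = ?q x" for x using assms(2) by (simp add: field_simps)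
  have "(F ^^ j) f x = ?q x + \<omega> ^ j * (f x - ?q x)" for j f x
  proof (induction j arbitrary: f x)
    case (Suc j)
    have "(F ^^ Suc j) f x = \<omega> * ?q x + k x + \<omega> ^ Suc j * (f x - ?q x)"
      by (simp add: assms(1) Suc algebra_simps)
    then show ?case by (simp only: q)
  qed simp
  then show ?thesis using assms(3) by (intro ext) simp
qed

lemma ex_root_of_unity:
  assumes "2 \<le> (n::nat)"
  shows "\<exists>\<omega>::complex. \<omega> ^ n = 1 \<and> \<omega> \<noteq> 1"
proof (rule ccontr)
  assume "\<not> ?thesis"
  then have "{\<omega>::complex. \<omega> ^ n = 1} \<subseteq> {1}" by blast
  from card_mono[OF _ this] have "card {\<omega>::complex. \<omega> ^ n = 1} \<le> 1" by simp
  then show False using card_roots_unity_eq[of n] assms by simp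
qed

text \<open>The linear map that shifts by \<open>r\<close> and multiplies by \<open>c\<close>,
  conjugated by the translation by \<open>q\<close>; thus maps with the same \<open>q\<close>
  commute.\<close>

definition fix_map :: "(real \<Rightarrow> complex) \<Rightarrow> complex \<Rightarrow> real \<Rightarrow> (real \<Rightarrow> complex) \<Rightarrow> real \<Rightarrow> complex" where
  "fix_map q c r f x = q x + c * (f (x - r) - q (x - r))"

lemma fix_map_comp: "fix_map q c r \<circ> fix_map q c' r' = fix_map q (c * c') (r + r')"
  by (auto simp: fix_map_def fun_eq_iff algebra_simps)

lemma fix_map_fixed: "fix_map q c r q = q"
  by (simp add: fix_map_def fun_eq_iff)

lemma affine_fix_map:
  assumes "c \<noteq> 0" "\<And>x. x < C \<Longrightarrow> q x = 0"
  shows "affine_map r (fix_map q c r)"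
  unfolding affine_map_def fix_map_def
  by (intro exI[of _ c] exI[of _ "\<lambda>x. q x - c * q (x - r)"] exI[of _ "min C (C + r)"])
    (use assms in \<open>auto simp: algebra_simps\<close>)

text \<open>The unit of the Novikov ring in the function model: it is supported at height 0.\<close>

definition delta :: "real \<Rightarrow> complex" where
  "delta x = (if x = 0 then 1 else 0)"

locale even_artin_character =
  fixes \<Gamma> :: "'a labeled_graph" and \<chi> :: "'a word set \<Rightarrow> real" and Y :: "'a word set set"
  assumes simplicial: "finite_simplicial \<Gamma>"
    and even_labels: "\<And>e. e \<in> edges \<Gamma> \<Longrightarrow> label \<Gamma> e \<ge> 2 \<and> even (label \<Gamma> e)"
    and char: "\<chi> \<in> nonzero_characters (artin_group \<Gamma>)"
    and gens: "finite_generating_set (artin_group \<Gamma>) Y"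

sublocale even_artin_character \<subseteq> generated_character "artin_group \<Gamma>" \<chi> Y
  using char gens
  by (intro generated_character.intro group_character.intro group_artin_group
      group_character_axioms.intro generated_character_axioms.intro)
    (auto simp: nonzero_characters_def finite_generating_set_def hom_def real_add_group_def)

context even_artin_character
begin

abbreviation "G \<equiv> artin_group \<Gamma>"
abbreviation "gen \<equiv> artin_gen \<Gamma>"
abbreviation "cayley_nonneg \<equiv> full_subgraph (cayley_graph G Y) (nonneg_part G \<chi>)"

lemma edge_verts:
  assumes "{u, v} \<in> edges \<Gamma>"
  shows "u \<in> verts \<Gamma>" "v \<in> verts \<Gamma>" "u \<noteq> v"
proof -
  obtain x y where "x \<in> verts \<Gamma>" "y \<in> verts \<Gamma>" "x \<noteq> y" "{u, v} = {x, y}"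
    using assms simplicial unfolding finite_simplicial_def by meson
  then show "u \<in> verts \<Gamma>" "v \<in> verts \<Gamma>" "u \<noteq> v" by (auto simp: doubleton_eq_iff)
qed

lemma gen_closed: "v \<in> verts \<Gamma> \<Longrightarrow> gen v \<in> carrier G"
  unfolding artin_group_def artin_gen_def by (rule presented_gen_carrier)

lemma verts_living: "verts (living_subgraph \<Gamma> \<chi>) = {v \<in> verts \<Gamma>. \<chi> (gen v) \<noteq> 0}"
  by (auto simp: living_subgraph_def living_full_subgraph_def full_subgraph_def)

lemma edges_living:
  "{u, v} \<in> edges (living_subgraph \<Gamma> \<chi>) \<longleftrightarrow>
    {u, v} \<in> edges \<Gamma> \<and> \<chi> (gen u) \<noteq> 0 \<and> \<chi> (gen v) \<noteq> 0 \<and>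
    \<not> (\<chi> (gen u) = - \<chi> (gen v) \<and> label \<Gamma> {u, v} > 2)"
proof -
  have "{u, v} \<in> dead_edges \<Gamma> \<chi> \<longleftrightarrow>
      {u, v} \<in> edges \<Gamma> \<and> \<chi> (gen u) = - \<chi> (gen v) \<and> label \<Gamma> {u, v} > 2"
    using even_labels by (auto simp: dead_edges_def doubleton_eq_iff insert_commute)
  then show ?thesis
    by (auto simp: living_subgraph_def living_full_subgraph_def full_subgraph_def)
qed

lemma ex_living: "\<exists>v\<in>verts \<Gamma>. \<chi> (gen v) \<noteq> 0"
proof (rule ccontr)
  assume *: "\<not> ?thesis"
  have "\<chi> g = 0" if "g \<in> generate G (gen ` verts \<Gamma>)" for g
    using that
  proof (induction rule: generate.induct)
    case (eng g h)
    then show ?case using generate_artin_gen[of \<Gamma>] by (simp add: char_mult)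
  qed (use * gen_closed in auto)
  then show False
    using char generate_artin_gen[of \<Gamma>] by (auto simp: nonzero_characters_def)
qed

section \<open>Necessity: affine actions of the Artin group\<close>

text \<open>Necessity is reduced to choosing one affine map per vertex. Commuting maps satisfy every
  relation of an even label, whence the first alternative.\<close>

lemma not_connected_if_affine_relations:
  assumes affine: "\<And>v. v \<in> verts \<Gamma> \<Longrightarrow> affine_map (\<chi> (gen v)) (\<phi> v)"
    and rel: "\<And>u v. {u, v} \<in> edges \<Gamma> \<Longrightarrow> \<phi> u \<circ> \<phi> v = \<phi> v \<circ> \<phi> u \<or>
      (\<phi> u \<circ> \<phi> v) ^^ (label \<Gamma> {u, v} div 2) = (\<phi> v \<circ> \<phi> u) ^^ (label \<Gamma> {u, v} div 2)"
    and a: "a \<in> verts \<Gamma>" "\<chi> (gen a) \<noteq> 0" "\<phi> a (\<lambda>_. 0) = (\<lambda>_. 0)"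
    and b: "b \<in> verts \<Gamma>" "\<phi> b (\<lambda>_. 0) \<noteq> (\<lambda>_. 0)"
  shows "\<not> connected_graph cayley_nonneg"
proof -
  have rel': "(\<phi> u \<circ> \<phi> v) ^^ (label \<Gamma> {u, v} div 2) = (\<phi> v \<circ> \<phi> u) ^^ (label \<Gamma> {u, v} div 2)"
    if "{u, v} \<in> edges \<Gamma>" for u v
    using rel[OF that] by metis
  obtain act where act: "act \<one>\<^bsub>G\<^esub> = id"
    "\<And>g h. \<lbrakk>g \<in> carrier G; h \<in> carrier G\<rbrakk> \<Longrightarrow> act (g \<otimes>\<^bsub>G\<^esub> h) = act g \<circ> act h"
    "\<And>v. v \<in> verts \<Gamma> \<Longrightarrow> act (gen v) = \<phi> v"
    using artin_group_action[of \<Gamma> \<phi>, OF affine_map_bij[OF affine] _ rel'] even_labels by blast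
  have X: "gen ` verts \<Gamma> \<subseteq> carrier G" "generate G (gen ` verts \<Gamma>) = carrier G"
    using gen_closed generate_artin_gen by auto
  show ?thesis
    by (rule not_connected_if_affine_action[of act, OF act(1,2) X, where a = "gen a" and b = "gen b"])
      (use affine a b gens gen_closed in \<open>auto simp: act(3) finite_generating_set_def\<close>)
qed

text \<open>A vertex \<open>w\<close> violating dominance has only neighbours of character 0. They
  act as the identity, so translating by \<open>delta\<close> at \<open>w\<close> respects the
  relations.\<close>

lemma dominant_if_connected:
  assumes "connected_graph cayley_nonneg"
  shows "dominant \<Gamma> (living_subgraph \<Gamma> \<chi>)"
proof (rule ccontr)
  assume "\<not> ?thesis"
  then obtain w where w: "w \<in> verts \<Gamma>" "\<chi> (gen w) = 0"
    and isolated: "\<And>u. {w, u} \<in> edges \<Gamma> \<Longrightarrow> u \<in> verts \<Gamma> \<Longrightarrow> \<chi> (gen u) = 0"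
    by (auto simp: dominant_def verts_living)
  obtain a where a: "a \<in> verts \<Gamma>" "\<chi> (gen a) \<noteq> 0" using ex_living by blast
  define \<phi> where "\<phi> v f x = f (x - \<chi> (gen v)) + (if v = w then delta x else 0)"
    for v x and f :: "real \<Rightarrow> complex"
  have "affine_map (\<chi> (gen v)) (\<phi> v)" for v
    unfolding affine_map_def \<phi>_def
    by (intro exI[of _ 1] exI[of _ "\<lambda>x. if v = w then delta x else 0"] exI[of _ 0])
      (auto simp: delta_def)
  moreover have "\<phi> u \<circ> \<phi> v = \<phi> v \<circ> \<phi> u" if "{u, v} \<in> edges \<Gamma>" for u v
  proof -
    have "u = w \<Longrightarrow> \<chi> (gen v) = 0" "v = w \<Longrightarrow> \<chi> (gen u) = 0"
      using isolated edge_verts[OF that] that by (auto simp: insert_commute)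
    then show ?thesis using w(2) by (auto simp: \<phi>_def fun_eq_iff algebra_simps)
  qed
  moreover have "\<phi> w (\<lambda>_. 0) \<noteq> (\<lambda>_. 0)"
    by (metis (mono_tags, lifting) \<phi>_def add_0 delta_def zero_neq_one)
  moreover have "\<phi> a (\<lambda>_. 0) = (\<lambda>_. 0)" using a w by (auto simp: \<phi>_def fun_eq_iff)
  ultimately have "\<not> connected_graph cayley_nonneg"
    using a w(1) by (intro not_connected_if_affine_relations[of \<phi> a w]) blast+
  then show False using assms by blast
qed

lemma living_connected_if_connected:
  assumes conn: "connected_graph cayley_nonneg"
    and odd_cycles: "\<And>vs. \<lbrakk>closed_reduced_path \<Gamma> vs;
      \<forall>e\<in>cycle_edges vs. label \<Gamma> e > 2\<rbrakk> \<Longrightarrow> odd (length vs)"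
  shows "connected_graph (living_subgraph \<Gamma> \<chi>)"
proof (rule ccontr)
  let ?L = "living_subgraph \<Gamma> \<chi>"
  let ?E = "{(x, y). x \<in> verts ?L \<and> y \<in> verts ?L \<and> {x, y} \<in> edges ?L}"
  assume "\<not> ?thesis"
  then obtain a b where a: "a \<in> verts ?L" and b: "b \<in> verts ?L" "(a, b) \<notin> ?E\<^sup>*"
    unfolding connected_graph_def by blast
  define A where "A = {v. (a, v) \<in> ?E\<^sup>*}"
  \<comment> \<open>An edge between vertices of nonzero character with exactly one end in
    \<open>A\<close> cannot survive in the living subgraph, so it is dead.\<close>
  have cross: "\<chi> (gen u) = - \<chi> (gen v)" "label \<Gamma> {u, v} > 2"
    if "{u, v} \<in> edges \<Gamma>" "\<chi> (gen u) \<noteq> 0" "\<chi> (gen v) \<noteq> 0" "u \<in> A \<longleftrightarrow> v \<notin> A" for u v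
  proof -
    have L: "u \<in> verts ?L" "v \<in> verts ?L" using that edge_verts by (auto simp: verts_living)
    have "{u, v} \<notin> edges ?L"
    proof
      assume "{u, v} \<in> edges ?L"
      then have "(u, v) \<in> ?E" "(v, u) \<in> ?E" using L by (auto simp: insert_commute)
      then have "v \<in> A" if "u \<in> A" using that rtrancl_into_rtrancl[of a u ?E v] by (simp add: A_def)
      moreover have "u \<in> A" if "v \<in> A"
        using that \<open>(v, u) \<in> ?E\<close> rtrancl_into_rtrancl[of a v ?E u] by (simp add: A_def)
      ultimately show False using that(4) by blast
    qed
    then show "\<chi> (gen u) = - \<chi> (gen v)" "label \<Gamma> {u, v} > 2"
      using that by (auto simp: edges_living)
  qed
  define adj where "adj u v \<longleftrightarrow>
    {u, v} \<in> edges \<Gamma> \<and> \<chi> (gen u) \<noteq> 0 \<and> \<chi> (gen v) \<noteq> 0 \<and> (u \<in> A \<longleftrightarrow> v \<notin> A)" for u v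
  \<comment> \<open>Along a cycle of crossing edges the vertices alternate between \<open>A\<close>
    and its complement, so the length is even; but all labels exceed 2, so it has to be odd.\<close>
  have "\<not> has_cycle (verts \<Gamma>) adj"
  proof
    assume "has_cycle (verts \<Gamma>) adj"
    then obtain vs where vs: "3 \<le> length vs" "distinct vs" "set vs \<subseteq> verts \<Gamma>"
      "\<And>i. i < length vs \<Longrightarrow> adj (vs ! i) (vs ! (Suc i mod length vs))"
      unfolding has_cycle_def by blast
    then have "closed_reduced_path \<Gamma> vs" "\<forall>e\<in>cycle_edges vs. label \<Gamma> e > 2"
      using cross by (auto simp: closed_reduced_path_def cycle_edges_def adj_def)
    then have "odd (length vs)" by (rule odd_cycles)
    moreover have "even (length vs)"
      using vs(1,4) by (intro alternating_cycle_even[of _ "\<lambda>i. vs ! i \<in> A"]) (auto simp: adj_def)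
    ultimately show False by blast
  qed
  moreover obtain root :: "nat \<Rightarrow> complex" where root:
    "\<And>n. 2 \<le> n \<Longrightarrow> root n ^ n = 1 \<and> root n \<noteq> 1" "\<And>n. root n \<noteq> 0"
  proof -
    \<comment> \<open>The values for \<open>n < 2\<close> are fillers; they are chosen nonzero
      because the forest lemma asks this of all pairs of vertices.\<close>
    have "\<exists>\<omega>::complex. \<omega> \<noteq> 0 \<and> (2 \<le> n \<longrightarrow> \<omega> ^ n = 1 \<and> \<omega> \<noteq> 1)" for n
    proof (cases "2 \<le> n")
      case True
      then obtain \<omega> :: complex where "\<omega> ^ n = 1" "\<omega> \<noteq> 1" using ex_root_of_unity by blast
      moreover from this(1) True have "\<omega> \<noteq> 0" by (auto simp: power_0_left)
      ultimately show ?thesis by blast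
    qed (auto intro: exI[of _ 1])
    then show thesis using that by metis
  qed
  moreover have "finite (verts \<Gamma>)" using simplicial by (simp add: finite_simplicial_def)
  moreover have "adj v u" if "adj u v" for u v using that by (auto simp: adj_def insert_commute)
  moreover have "\<not> adj u u" for u by (simp add: adj_def)
  ultimately obtain c where c: "\<And>v. c v \<noteq> 0"
    "\<And>u v. \<lbrakk>u \<in> verts \<Gamma>; v \<in> verts \<Gamma>; adj u v\<rbrakk> \<Longrightarrow> c u * c v = root (label \<Gamma> {u, v} div 2)"
    using forest_edge_products[of "verts \<Gamma>" adj "\<lambda>u v. root (label \<Gamma> {u, v} div 2)"]
    by (metis insert_commute)
  define q where "q v = (if v \<in> A then (\<lambda>_. 0) else delta)" for v
  \<comment> \<open>A vertex of character 0 acts trivially and so commutes with all others. The rest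
    fix 0 or \<open>delta\<close> according to their side of the cut.\<close>
  define \<phi> where "\<phi> v = (if \<chi> (gen v) = 0 then id else fix_map (q v) (c v) (\<chi> (gen v)))" for v
  have "affine_map (\<chi> (gen v)) (\<phi> v)" for v
    using affine_fix_map[of "c v" 0 "q v" "\<chi> (gen v)"] c(1)
    by (auto simp: \<phi>_def affine_map_id q_def delta_def)
  moreover have "\<phi> u \<circ> \<phi> v = \<phi> v \<circ> \<phi> u \<or>
      (\<phi> u \<circ> \<phi> v) ^^ (label \<Gamma> {u, v} div 2) = (\<phi> v \<circ> \<phi> u) ^^ (label \<Gamma> {u, v} div 2)"
    if uv: "{u, v} \<in> edges \<Gamma>" for u v
  proof (cases "adj u v")
    case False
    \<comment> \<open>Such an edge has an end that acts trivially, or both ends lie on the same side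
      and their maps share a fixed point.\<close>
    then have "\<chi> (gen u) = 0 \<or> \<chi> (gen v) = 0 \<or> q u = q v"
      using uv by (auto simp: adj_def q_def)
    then show ?thesis by (auto simp: \<phi>_def fix_map_comp mult.commute add.commute)
  next
    case True
    let ?n = "label \<Gamma> {u, v} div 2"
    have chi: "\<chi> (gen u) \<noteq> 0" "\<chi> (gen v) = - \<chi> (gen u)" and "label \<Gamma> {u, v} > 2"
      using True cross[of u v] by (auto simp: adj_def)
    then have "2 \<le> ?n" using even_labels[OF uv] by presburger
    then have \<omega>: "c u * c v \<noteq> 1" "(c u * c v) ^ ?n = 1"
      using root c(2)[OF edge_verts(1,2)[OF uv] True] by auto
    \<comment> \<open>The shifts by \<open>s\<close> and \<open>- s\<close> cancel, so the composite
      multiplies pointwise by the root of unity; \<open>k\<close> collects the terms free of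
      \<open>f\<close>. Used for both orders of the product.\<close>
    have "(fix_map p d s \<circ> fix_map p' d' (- s)) ^^ ?n = id" if "d * d' = c u * c v" for p p' d d' s
      by (rule root_of_unity_map_pow[OF _ \<omega>,
            where k = "\<lambda>x. p x + d * (p' (x - s) - p (x - s)) - c u * c v * p' x"])
        (simp add: fix_map_def that[symmetric] algebra_simps)
    from this[of "c u" "c v"] this[of "c v" "c u" "q v" "- \<chi> (gen u)" "q u"]
    show ?thesis using chi by (simp add: \<phi>_def mult.commute)
  qed
  moreover have "\<phi> a (\<lambda>_. 0) = (\<lambda>_. 0)"
    using fix_map_fixed[of "\<lambda>_. 0"] by (auto simp: \<phi>_def q_def A_def)
  \<comment> \<open>At 0 the shifted copy of \<open>delta\<close> vanishes because
    \<open>\<chi> (gen b) \<noteq> 0\<close>, leaving the value 1.\<close>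
  moreover have "\<phi> b (\<lambda>_. 0) 0 \<noteq> 0"
    using b by (auto simp: \<phi>_def q_def A_def fix_map_def delta_def verts_living)
  then have "\<phi> b (\<lambda>_. 0) \<noteq> (\<lambda>_. 0)" by metis
  ultimately have "\<not> connected_graph cayley_nonneg"
    using a b by (intro not_connected_if_affine_relations[of \<phi> a b]) (auto simp: verts_living)
  then show False using conn by blast
qed

section \<open>Sufficiency: central elements of edges and a common end\<close>

lemma edge_pow:
  assumes "{u, v} \<in> edges \<Gamma>" and n: "label \<Gamma> {u, v} = 2 * n"
  shows "(gen u \<otimes>\<^bsub>G\<^esub> gen v) [^]\<^bsub>G\<^esub> n = (gen v \<otimes>\<^bsub>G\<^esub> gen u) [^]\<^bsub>G\<^esub> n"
proof -
  let ?S = "verts \<Gamma>" and ?R = "artin_relators \<Gamma>"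
  let ?c = "\<lambda>w. word_rel ?S ?R `` {w}"
  have alt: "alternating x y k \<in> words ?S" if "x \<in> ?S" "y \<in> ?S" for x y k
    using that by (induction x y k rule: alternating.induct) (auto simp: words_def)
  have pow: "(gen x \<otimes>\<^bsub>G\<^esub> gen y) [^]\<^bsub>G\<^esub> k = ?c (alternating x y (2 * k))"
    if xy: "x \<in> ?S" "y \<in> ?S" for x y k
  proof (induction k)
    case 0
    then show ?case by (simp add: artin_group_def presented_group_def)
  next
    case (Suc k)
    have w: "[(x, True)] \<in> words ?S" "[(y, True)] \<in> words ?S" "[(x, True), (y, True)] \<in> words ?S"
      using xy by (auto simp: words_def)
    have xy_word: "gen x \<otimes>\<^bsub>G\<^esub> gen y = ?c [(x, True), (y, True)]"
      unfolding artin_group_def artin_gen_def presented_gen_def presented_mult[OF w(1,2)] by simp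
    have "(gen x \<otimes>\<^bsub>G\<^esub> gen y) [^]\<^bsub>G\<^esub> Suc k = (gen x \<otimes>\<^bsub>G\<^esub> gen y) \<otimes>\<^bsub>G\<^esub> (gen x \<otimes>\<^bsub>G\<^esub> gen y) [^]\<^bsub>G\<^esub> k"
      using xy gen_closed by (intro nat_pow_Suc2) simp
    also have "\<dots> = ?c ([(x, True), (y, True)] @ alternating x y (2 * k))"
      unfolding Suc unfolding xy_word by (rule presented_mult[OF w(3) alt[OF xy], of ?R, folded artin_group_def])
    finally show ?case by simp
  qed
  have uv: "u \<in> ?S" "v \<in> ?S" using edge_verts[OF assms(1)] by auto
  have "(alternating u v (2 * n), alternating v u (2 * n)) \<in> ?R"
    using assms(1) unfolding artin_relators_def n[symmetric] by blast
  then have "word_eq ?S ?R (alternating u v (2 * n)) (alternating v u (2 * n))"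
    using alt uv by (intro word_eq.weq_relator)
  then have "?c (alternating u v (2 * n)) = ?c (alternating v u (2 * n))"
    by (intro equiv_class_eq[OF equiv_word_rel]) (simp add: word_rel_def)
  then show ?thesis using pow uv by simp
qed

text \<open>The witness is \<open>z = (uv)^n\<close>: always \<open>u (vu)^n = (uv)^n u\<close>, and
  the relation \<open>(uv)^n = (vu)^n\<close> turns this into commutation; likewise for
  \<open>v\<close>.\<close>

lemma edge_central:
  assumes "{u, v} \<in> edges \<Gamma>"
  obtains z where "z \<in> carrier G" "gen u \<otimes>\<^bsub>G\<^esub> z = z \<otimes>\<^bsub>G\<^esub> gen u" "gen v \<otimes>\<^bsub>G\<^esub> z = z \<otimes>\<^bsub>G\<^esub> gen v"
    "\<chi> z = real (label \<Gamma> {u, v} div 2) * (\<chi> (gen u) + \<chi> (gen v))"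
proof -
  let ?n = "label \<Gamma> {u, v} div 2"
  have n: "label \<Gamma> {u, v} = 2 * ?n" using even_labels[OF assms] by simp
  have g: "gen u \<in> carrier G" "gen v \<in> carrier G" using edge_verts[OF assms] gen_closed by auto
  have shift: "x \<otimes>\<^bsub>G\<^esub> (y \<otimes>\<^bsub>G\<^esub> x) [^]\<^bsub>G\<^esub> k = (x \<otimes>\<^bsub>G\<^esub> y) [^]\<^bsub>G\<^esub> k \<otimes>\<^bsub>G\<^esub> x"
    if "x \<in> carrier G" "y \<in> carrier G" for x y and k :: nat
  proof (induction k)
    case (Suc k)
    have "x \<otimes>\<^bsub>G\<^esub> (y \<otimes>\<^bsub>G\<^esub> x) [^]\<^bsub>G\<^esub> Suc k = (x \<otimes>\<^bsub>G\<^esub> (y \<otimes>\<^bsub>G\<^esub> x) [^]\<^bsub>G\<^esub> k) \<otimes>\<^bsub>G\<^esub> (y \<otimes>\<^bsub>G\<^esub> x)"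
      using that by (simp add: m_assoc)
    also have "\<dots> = (x \<otimes>\<^bsub>G\<^esub> y) [^]\<^bsub>G\<^esub> Suc k \<otimes>\<^bsub>G\<^esub> x"
      unfolding Suc using that by (simp add: m_assoc)
    finally show ?case .
  qed (use that in simp)
  let ?z = "(gen u \<otimes>\<^bsub>G\<^esub> gen v) [^]\<^bsub>G\<^esub> ?n"
  have z: "?z = (gen v \<otimes>\<^bsub>G\<^esub> gen u) [^]\<^bsub>G\<^esub> ?n" by (rule edge_pow[OF assms n])
  show thesis
  proof (rule that)
    show "?z \<in> carrier G" using g by simp
    show "gen u \<otimes>\<^bsub>G\<^esub> ?z = ?z \<otimes>\<^bsub>G\<^esub> gen u" using shift[OF g, of ?n] z by simp
    show "gen v \<otimes>\<^bsub>G\<^esub> ?z = ?z \<otimes>\<^bsub>G\<^esub> gen v" using shift[OF g(2,1), of ?n] z by simp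
    show "\<chi> ?z = real ?n * (\<chi> (gen u) + \<chi> (gen v))" using g by (simp add: char_mult)
  qed
qed

text \<open>For label 2 the generators commute, so their rays can be compared directly even if their
  characters cancel. For larger labels the characters do not cancel, so the central \<open>z\<close>
  has nonzero character and its ray links both.\<close>

lemma living_edge_ray_eq:
  assumes e: "{u, v} \<in> edges (living_subgraph \<Gamma> \<chi>)"
  shows "ray_eq \<one>\<^bsub>G\<^esub> (pos (gen u)) \<one>\<^bsub>G\<^esub> (pos (gen v))"
proof -
  have e': "{u, v} \<in> edges \<Gamma>" "\<chi> (gen u) \<noteq> 0" "\<chi> (gen v) \<noteq> 0"
    and living: "\<not> (\<chi> (gen u) = - \<chi> (gen v) \<and> label \<Gamma> {u, v} > 2)"
    using e by (auto simp: edges_living)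
  have g: "gen u \<in> carrier G" "gen v \<in> carrier G" using edge_verts[OF e'(1)] gen_closed by auto
  show ?thesis
  proof (cases "label \<Gamma> {u, v} = 2")
    case True
    then have "gen u \<otimes>\<^bsub>G\<^esub> gen v = gen v \<otimes>\<^bsub>G\<^esub> gen u"
      using edge_pow[OF e'(1), of 1] g by simp
    then show ?thesis using g e' by (intro ray_eq_pos_commuting)
  next
    case False
    then have "label \<Gamma> {u, v} > 2" "\<chi> (gen u) + \<chi> (gen v) \<noteq> 0"
      using even_labels[OF e'(1)] living by auto
    moreover obtain z where z: "z \<in> carrier G"
      "gen u \<otimes>\<^bsub>G\<^esub> z = z \<otimes>\<^bsub>G\<^esub> gen u" "gen v \<otimes>\<^bsub>G\<^esub> z = z \<otimes>\<^bsub>G\<^esub> gen v"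
      "\<chi> z = real (label \<Gamma> {u, v} div 2) * (\<chi> (gen u) + \<chi> (gen v))"
      using edge_central[OF e'(1)] .
    ultimately have z0: "\<chi> z \<noteq> 0" by simp
    show ?thesis
      using ray_eq_pos_commuting[OF g(1) z(1) e'(2) z0 z(2)]
        ray_eq_sym[OF ray_eq_pos_commuting[OF g(2) z(1) e'(3) z0 z(3)]]
      by (rule ray_eq_trans)
  qed
qed

lemma connected_if_living:
  assumes conn: "connected_graph (living_subgraph \<Gamma> \<chi>)"
    and dom: "dominant \<Gamma> (living_subgraph \<Gamma> \<chi>)"
  shows "connected_graph cayley_nonneg"
proof -
  let ?L = "living_subgraph \<Gamma> \<chi>"
  obtain a where a: "a \<in> verts \<Gamma>" "\<chi> (gen a) \<noteq> 0" using ex_living by blast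
  let ?t = "pos (gen a)"
  have t: "?t \<in> carrier G" "\<chi> ?t > 0" using a gen_closed by (auto simp: pos_closed char_pos)
  have living: "ray_eq \<one>\<^bsub>G\<^esub> ?t \<one>\<^bsub>G\<^esub> (pos (gen v))" if "v \<in> verts ?L" for v
  proof -
    have "(a, v) \<in> {(x, y). x \<in> verts ?L \<and> y \<in> verts ?L \<and> {x, y} \<in> edges ?L}\<^sup>*"
      using conn that a unfolding connected_graph_def by (simp add: verts_living)
    then show ?thesis
    proof (induction rule: rtrancl_induct)
      case base
      show ?case using ray_eq_commuting[OF t t refl] .
    next
      case (step x y)
      then show ?case using ray_eq_trans living_edge_ray_eq by blast
    qed
  qed
  \<comment> \<open>The end of \<open>?t\<close> is also that of \<open>pos z\<close>, through the
    living vertex \<open>u\<close>; and \<open>x\<close> fixes the latter as it commutes with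
    \<open>z\<close>.\<close>
  have fixed: "ray_eq x ?t \<one>\<^bsub>G\<^esub> ?t"
    if u: "u \<in> verts ?L" and x: "x \<in> carrier G" and z: "z \<in> carrier G" "\<chi> z \<noteq> 0"
      and comm: "gen u \<otimes>\<^bsub>G\<^esub> z = z \<otimes>\<^bsub>G\<^esub> gen u" "x \<otimes>\<^bsub>G\<^esub> z = z \<otimes>\<^bsub>G\<^esub> x" for u x z
  proof -
    have u': "gen u \<in> carrier G" "\<chi> (gen u) \<noteq> 0"
      using u gen_closed by (auto simp: verts_living)
    have pz: "pos z \<in> carrier G" "\<chi> (pos z) > 0" using z by (auto simp: pos_closed char_pos)
    have tz: "ray_eq \<one>\<^bsub>G\<^esub> ?t \<one>\<^bsub>G\<^esub> (pos z)"
      using living[OF u] ray_eq_pos_commuting[OF u'(1) z(1) u'(2) z(2) comm(1)] by (rule ray_eq_trans)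
    have "ray_eq x ?t x (pos z)"
      using ray_eq_translate[OF tz x one_closed one_closed t(1) pz(1)] x by simp
    also have "ray_eq x (pos z) \<one>\<^bsub>G\<^esub> (pos z)"
      using ray_eq_centralizer[OF pz x pos_commute[OF x z(1) comm(2)]] .
    also have "ray_eq \<one>\<^bsub>G\<^esub> (pos z) \<one>\<^bsub>G\<^esub> ?t" by (rule ray_eq_sym[OF tz])
    finally show ?thesis .
  qed
  have "ray_eq (gen v) ?t \<one>\<^bsub>G\<^esub> ?t" if v: "v \<in> verts \<Gamma>" for v
  proof (cases "\<chi> (gen v) = 0")
    case False
    then show ?thesis
      using v gen_closed by (intro fixed[of v _ "gen v"]) (auto simp: verts_living)
  next
    case True
    then obtain u where u: "u \<in> verts ?L" "{v, u} \<in> edges \<Gamma>"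
      using dom v unfolding dominant_def by (auto simp: verts_living)
    obtain z where z: "z \<in> carrier G" "gen v \<otimes>\<^bsub>G\<^esub> z = z \<otimes>\<^bsub>G\<^esub> gen v" "gen u \<otimes>\<^bsub>G\<^esub> z = z \<otimes>\<^bsub>G\<^esub> gen u"
      "\<chi> z = real (label \<Gamma> {v, u} div 2) * (\<chi> (gen v) + \<chi> (gen u))"
      using edge_central[OF u(2)] .
    \<comment> \<open>Here \<open>\<chi> (gen v) = 0\<close>, so \<open>\<chi> z\<close> is a
      positive multiple of \<open>\<chi> (gen u)\<close>, which is nonzero at a living
      vertex.\<close>
    have "\<chi> z \<noteq> 0" using z(4) True u(1) even_labels[OF u(2)] by (auto simp: verts_living)
    then show ?thesis using fixed[OF u(1) gen_closed[OF v] z(1) _ z(3,2)] by blast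
  qed
  then show ?thesis
    using connected_if_ray_fixed[OF t, of "gen ` verts \<Gamma>"] gen_closed generate_artin_gen by blast
qed

end

theorem theoremA:
  fixes \<Gamma> :: "'a labeled_graph" and Y :: "'a word set set"
  assumes "finite_simplicial \<Gamma>"
    and "\<forall>e\<in>edges \<Gamma>. label \<Gamma> e \<ge> 2 \<and> even (label \<Gamma> e)"
    and "\<forall>vs. closed_reduced_path \<Gamma> vs \<and> (\<forall>e\<in>cycle_edges vs. label \<Gamma> e > 2) \<longrightarrow> odd (length vs)"
    and "finite_generating_set (artin_group \<Gamma>) Y"
  shows "Sigma1 (artin_group \<Gamma>) Y =
    {character_class (artin_group \<Gamma>) \<chi> | \<chi>. \<chi> \<in> nonzero_characters (artin_group \<Gamma>) \<and>
       connected_graph (living_subgraph \<Gamma> \<chi>) \<and> dominant \<Gamma> (living_subgraph \<Gamma> \<chi>)}"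
proof -
  have "connected_graph (full_subgraph (cayley_graph (artin_group \<Gamma>) Y) (nonneg_part (artin_group \<Gamma>) \<chi>)) \<longleftrightarrow>
      connected_graph (living_subgraph \<Gamma> \<chi>) \<and> dominant \<Gamma> (living_subgraph \<Gamma> \<chi>)"
    if "\<chi> \<in> nonzero_characters (artin_group \<Gamma>)" for \<chi>
  proof -
    interpret even_artin_character \<Gamma> \<chi> Y
      using assms that by unfold_locales auto
    show ?thesis
      using connected_if_living dominant_if_connected living_connected_if_connected assms(3) by blast
  qed
  then show ?thesis unfolding Sigma1_def by blast
qed

end
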